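(* Let $(\chi_0,\chi_1,N_0)$ be a set of classical shock front initial data with initial shock front $\sigma_0\in(0,\infty)$. Then there exist $T>0$, depending on $(\chi_0,\chi_1)$, and a unique classical shock solution $(\chi,N)$ on the time interval $[0,T]$ with initial data $(\chi_0,\chi_1,N_0)$.
   Context: Standing constants (units chosen so that mass density and elastic modulus equal $1$): $N_1>1$, $0<\eta<N_1$, $\tau\in(\eta,N_1)$, $\zeta\ge 0$ are fixed. Here $\chi(s,t)$ is the position at time $t$ of the particle $s\in[0,\infty)$ of a string and $N(s,t)$ its tension. For a function $g$, $g(\infty)$ means $\lim_{s\to\infty}g(s)$; likewise $g(\infty,t)=\lim_{s\to\infty}g(s,t)$. A superscript $+$ as in $g(\sigma^+,t)$ denotes the limit from the right in $s$. $C^k$ on a closed region means that the function and its derivatives up to order $k$ extend continuously to the boundary; at the interface between two regions, values are understood as one-sided limits from the region in question. Classical shock front initial data: a triple $(\chi_0,\chi_1,N_0)$ of real-valued functions on $[0,\infty)$ with $\chi_0\in C([0,\infty))$, $\chi_1\in L^\infty_{loc}([0,\infty))$, $N_0\in L^\infty([0,\infty))$ for which there is a unique $\sigma_0\in(0,\infty)$ (the initial shock front) such that (1) $\chi_0\in C^2([\sigma_0,\infty))$, $\chi_1\in C^1([\sigma_0,\infty))$, $N_0\in C^1([\sigma_0,\infty))$; (2) for all $s\in[\sigma_0,\infty)$, $N_0(s)=\chi_0'(s)$ and $\eta<N_0(s)<N_1$; (3) $\chi_0'(\infty)=\tau$, $\chi_1'(\infty)=\zeta$, $\chi_0(\sigma_0)=N_1\sigma_0$;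 (4) $v_0:=\dfrac{\chi_1(\sigma_0^+)}{N_1-\chi_0'(\sigma_0^+)}>1$; (5) for all $s\in[0,\sigma_0]$: $\chi_0(s)=N_1 s$, $\chi_1(s)=0$, $N_0(s)=N_0(\sigma_0^+)+v_0^2\,(N_1-N_0(\sigma_0^+))>N_1$. Classical shock solution on $[0,T]$ with initial data $(\chi_0,\chi_1,N_0)$: a pair $(\chi,N)$ with $\chi\in C([0,\infty)\times[0,T])$, $N\in L^\infty([0,\infty)\times[0,T])$, $\partial_t\chi\in L^\infty_{loc}([0,\infty)\times[0,T])$, for which there is a unique curve $\sigma\in C^2([0,T];[\sigma_0,\infty))$ (the shock front) with $\sigma(0)=\sigma_0$ such that, with $\mathcal E_\sigma=\{(s,t):t\in[0,T],\ s\in[\sigma(t),\infty)\}$ and $\mathcal I_\sigma=\{(s,t):t\in[0,T],\ s\in[0,\sigma(t)]\}$ (writing $\sigma=\sigma(t)$), (1) $\chi\in C^2(\mathcal E_\sigma)$ and $N\in C^1(\mathcal E_\sigma)$; (2) on $\mathcal E_\sigma$: $N=\chi_s$ and $\eta<N<N_1$; (3) $\chi(\sigma^+,t)=N_1\sigma$; (4) $\sigma'(t)=\dfrac{\chi_t(\sigma^+,t)}{N_1-N(\sigma^+,t)}>1$; (5) on $\mathcal I_\sigma$: $\chi(s,t)=N_1 s$ and $N(s,t)=N(\sigma^+,t)+(\sigma')^2(N_1-N(\sigma^+,t))>N_1$; (6) on $\mathcal E_\sigma$: $\chi_{tt}=\chi_{ss}$, $\chi_s(\infty,t)=\zeta t+\tau$,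 and $\chi(s,0)=\chi_0(s)$, $\chi_t(s,0)=\chi_1(s)$ for $s\ge\sigma_0$. *)

theory Defs
  imports "HOL-Analysis.Analysis"
begin

text \<open>
  Functions on [0,oo) and on [0,oo) x [0,T] are total functions; only their values on these
  sets matter.  A point of space-time is a pair (s, t).
\<close>

section \<open>Regularity up to the boundary of a closed region\<close>

definition extends_cont :: "'a::topological_space set \<Rightarrow> ('a \<Rightarrow> real) \<Rightarrow> bool" where
  "extends_cont R f \<longleftrightarrow> (\<exists>F. continuous_on R F \<and> (\<forall>p\<in>interior R. F p = f p))"

text \<open>
  The value at p of the continuous extension of f from the interior of R.  All regions below
  are the closure of their interior, so this is the value of f "from the region R".  At a
  point of an interface it need not be the value of the total function f.
\<close>

definition trace :: "'a::t2_space set \<Rightarrow> ('a \<Rightarrow> real) \<Rightarrow> 'a \<Rightarrow> real" where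
  "trace R f p = Lim (at p within interior R) f"

definition ds :: "(real \<times> real \<Rightarrow> real) \<Rightarrow> real \<times> real \<Rightarrow> real" where
  "ds f = (\<lambda>(s, t). deriv (\<lambda>x. f (x, t)) s)"

definition dt :: "(real \<times> real \<Rightarrow> real) \<Rightarrow> real \<times> real \<Rightarrow> real" where
  "dt f = (\<lambda>(s, t). deriv (\<lambda>y. f (s, y)) t)"

text \<open>
  \<open>C\<^sup>k\<close> on a closed region: the derivatives up to order k exist in the interior and they, like
  the function itself, extend continuously to the region.
\<close>

primrec Ck_line :: "nat \<Rightarrow> real set \<Rightarrow> (real \<Rightarrow> real) \<Rightarrow> bool" where
  "Ck_line 0 R f \<longleftrightarrow> extends_cont R f"
| "Ck_line (Suc k) R f \<longleftrightarrow> extends_cont R f \<and>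
     (\<forall>x\<in>interior R. f field_differentiable at x) \<and> Ck_line k R (deriv f)"

primrec Ck_plane :: "nat \<Rightarrow> (real \<times> real) set \<Rightarrow> (real \<times> real \<Rightarrow> real) \<Rightarrow> bool" where
  "Ck_plane 0 R f \<longleftrightarrow> extends_cont R f"
| "Ck_plane (Suc k) R f \<longleftrightarrow> extends_cont R f \<and>
     (\<forall>(s, t)\<in>interior R. (\<lambda>x. f (x, t)) field_differentiable at s \<and>
                          (\<lambda>y. f (s, y)) field_differentiable at t) \<and>
     Ck_plane k R (ds f) \<and> Ck_plane k R (dt f)"

section \<open>Bounded measurable functions and weak derivatives\<close>

definition Linf_on :: "'a::euclidean_space set \<Rightarrow> ('a \<Rightarrow> real) \<Rightarrow> bool" where
  "Linf_on D f \<longleftrightarrow> f \<in> borel_measurable (lebesgue_on D) \<and>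
     (\<exists>B. AE x in lebesgue_on D. \<bar>f x\<bar> \<le> B)"

definition Linf_loc_on :: "'a::euclidean_space set \<Rightarrow> ('a \<Rightarrow> real) \<Rightarrow> bool" where
  "Linf_loc_on D f \<longleftrightarrow> (\<forall>K. compact K \<and> K \<subseteq> D \<longrightarrow> Linf_on K f)"

definition test_function_on :: "(real \<times> real) set \<Rightarrow> (real \<times> real \<Rightarrow> real) \<Rightarrow> bool" where
  "test_function_on U \<phi> \<longleftrightarrow> (\<forall>k. Ck_plane k UNIV \<phi>) \<and>
     (\<exists>K. compact K \<and> K \<subseteq> U \<and> (\<forall>p. p \<notin> K \<longrightarrow> \<phi> p = 0))"

definition has_weak_dt_on ::
  "(real \<times> real \<Rightarrow> real) \<Rightarrow> (real \<times> real \<Rightarrow> real) \<Rightarrow> (real \<times> real) set \<Rightarrow> bool" where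
  "has_weak_dt_on f g D \<longleftrightarrow> (\<forall>\<phi>. test_function_on (interior D) \<phi> \<longrightarrow>
     (LINT p:D|lebesgue. f p * dt \<phi> p) = - (LINT p:D|lebesgue. g p * \<phi> p))"

definition rlim :: "(real \<Rightarrow> real) \<Rightarrow> real \<Rightarrow> real" where
  "rlim g a = Lim (at_right a) g"

section \<open>Classical shock front initial data\<close>

definition front_speed0 :: "real \<Rightarrow> (real \<Rightarrow> real) \<Rightarrow> (real \<Rightarrow> real) \<Rightarrow> real \<Rightarrow> real" where
  "front_speed0 N1 chi0 chi1 \<sigma>0 = rlim chi1 \<sigma>0 / (N1 - rlim (deriv chi0) \<sigma>0)"

text \<open>
  The data N0, chi1 jump at the front: from the right, N0 < N1 and chi1 > 0, from the left
  N0 > N1 and chi1 = 0.  Their values at the single point \<open>\<sigma>0\<close> are left free; conditions there are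
  conditions on one-sided limits (from the left these follow from the values for \<open>s < \<sigma>0\<close>, which
  are constant).
\<close>

definition is_initial_front ::
  "real \<Rightarrow> real \<Rightarrow> real \<Rightarrow> real \<Rightarrow> (real \<Rightarrow> real) \<Rightarrow> (real \<Rightarrow> real) \<Rightarrow> (real \<Rightarrow> real) \<Rightarrow> real \<Rightarrow> bool"
where
  "is_initial_front N1 \<eta> \<tau> \<zeta> chi0 chi1 N0 \<sigma>0 \<longleftrightarrow>
     0 < \<sigma>0 \<and>
     Ck_line 2 {\<sigma>0..} chi0 \<and> Ck_line 1 {\<sigma>0..} chi1 \<and> Ck_line 1 {\<sigma>0..} N0 \<and>
     (\<forall>s\<ge>\<sigma>0. trace {\<sigma>0..} N0 s = trace {\<sigma>0..} (deriv chi0) s \<and>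
              \<eta> < trace {\<sigma>0..} N0 s \<and> trace {\<sigma>0..} N0 s < N1) \<and>
     (deriv chi0 \<longlongrightarrow> \<tau>) at_top \<and> (deriv chi1 \<longlongrightarrow> \<zeta>) at_top \<and> chi0 \<sigma>0 = N1 * \<sigma>0 \<and>
     front_speed0 N1 chi0 chi1 \<sigma>0 > 1 \<and>
     (\<forall>s\<in>{0..\<sigma>0}. chi0 s = N1 * s) \<and>
     (\<forall>s\<in>{0..<\<sigma>0}. chi1 s = 0 \<and>
        N0 s = rlim N0 \<sigma>0 + (front_speed0 N1 chi0 chi1 \<sigma>0)\<^sup>2 * (N1 - rlim N0 \<sigma>0) \<and>
        N0 s > N1)"

definition shock_front_initial_data ::
  "real \<Rightarrow> real \<Rightarrow> real \<Rightarrow> real \<Rightarrow> (real \<Rightarrow> real) \<Rightarrow> (real \<Rightarrow> real) \<Rightarrow> (real \<Rightarrow> real) \<Rightarrow> bool" where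
  "shock_front_initial_data N1 \<eta> \<tau> \<zeta> chi0 chi1 N0 \<longleftrightarrow>
     continuous_on {0..} chi0 \<and> Linf_loc_on {0..} chi1 \<and> Linf_on {0..} N0 \<and>
     (\<exists>!\<sigma>0. is_initial_front N1 \<eta> \<tau> \<zeta> chi0 chi1 N0 \<sigma>0)"

definition initial_front ::
  "real \<Rightarrow> real \<Rightarrow> real \<Rightarrow> real \<Rightarrow> (real \<Rightarrow> real) \<Rightarrow> (real \<Rightarrow> real) \<Rightarrow> (real \<Rightarrow> real) \<Rightarrow> real" where
  "initial_front N1 \<eta> \<tau> \<zeta> chi0 chi1 N0 = (THE \<sigma>0. is_initial_front N1 \<eta> \<tau> \<zeta> chi0 chi1 N0 \<sigma>0)"

section \<open>Classical shock solutions\<close>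

definition ext_region :: "real \<Rightarrow> (real \<Rightarrow> real) \<Rightarrow> (real \<times> real) set" where
  "ext_region T \<sigma> = {(s, t). t \<in> {0..T} \<and> \<sigma> t \<le> s}"

text \<open>
  As for the data, N is left free on the front \<open>s = \<sigma> t\<close> itself, and the conditions
  on N at the front concern the limits from either side (on the inner side they follow
  from the values for \<open>s < \<sigma> t\<close>, which do not depend on s).  Derivatives of chi at boundary
  points of the exterior region, including t = 0 and t = T, are continuous extensions from its
  interior.
\<close>

definition is_shock_front ::
  "real \<Rightarrow> real \<Rightarrow> real \<Rightarrow> real \<Rightarrow> (real \<Rightarrow> real) \<Rightarrow> (real \<Rightarrow> real) \<Rightarrow> (real \<Rightarrow> real) \<Rightarrow> real
   \<Rightarrow> (real \<times> real \<Rightarrow> real) \<Rightarrow> (real \<times> real \<Rightarrow> real) \<Rightarrow> (real \<Rightarrow> real) \<Rightarrow> bool"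
where
  "is_shock_front N1 \<eta> \<tau> \<zeta> chi0 chi1 N0 T chi N \<sigma> \<longleftrightarrow>
    (let \<sigma>0 = initial_front N1 \<eta> \<tau> \<zeta> chi0 chi1 N0;
         E = ext_region T \<sigma>;
         d\<sigma> = trace {0..T} (deriv \<sigma>);
         chi_s = trace E (ds chi);
         chi_t = trace E (dt chi);
         Nr = (\<lambda>t. rlim (\<lambda>s. N (s, t)) (\<sigma> t))
     in
       continuous_on {0..T} \<sigma> \<and> Ck_line 2 {0..T} \<sigma> \<and> (\<forall>t\<in>{0..T}. \<sigma>0 \<le> \<sigma> t) \<and> \<sigma> 0 = \<sigma>0 \<and>
       Ck_plane 2 E chi \<and> Ck_plane 1 E N \<and>
       (\<forall>p\<in>E. trace E N p = chi_s p \<and> \<eta> < trace E N p \<and> trace E N p < N1) \<and>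
       (\<forall>(s, t)\<in>E. \<sigma> t < s \<longrightarrow> N (s, t) = chi_s (s, t)) \<and>
       (\<forall>t\<in>{0..T}. rlim (\<lambda>s. chi (s, t)) (\<sigma> t) = N1 * \<sigma> t) \<and>
       (\<forall>t\<in>{0..T}. d\<sigma> t = rlim (\<lambda>s. chi_t (s, t)) (\<sigma> t) / (N1 - Nr t) \<and> d\<sigma> t > 1) \<and>
       (\<forall>t\<in>{0..T}. \<forall>s\<in>{0..\<sigma> t}. chi (s, t) = N1 * s) \<and>
       (\<forall>t\<in>{0..T}. \<forall>s\<in>{0..<\<sigma> t}.
          N (s, t) = Nr t + (d\<sigma> t)\<^sup>2 * (N1 - Nr t) \<and> N (s, t) > N1) \<and>
       (\<forall>p\<in>E. trace E (dt (dt chi)) p = trace E (ds (ds chi)) p) \<and>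
       (\<forall>t\<in>{0..T}. ((\<lambda>s. chi_s (s, t)) \<longlongrightarrow> \<zeta> * t + \<tau>) at_top) \<and>
       (\<forall>s\<ge>\<sigma>0. chi (s, 0) = chi0 s \<and> chi_t (s, 0) = trace {\<sigma>0..} chi1 s))"

text \<open>Uniqueness of the front means uniqueness as a function on [0,T].\<close>

definition classical_shock_solution ::
  "real \<Rightarrow> real \<Rightarrow> real \<Rightarrow> real \<Rightarrow> (real \<Rightarrow> real) \<Rightarrow> (real \<Rightarrow> real) \<Rightarrow> (real \<Rightarrow> real) \<Rightarrow> real
   \<Rightarrow> (real \<times> real \<Rightarrow> real) \<Rightarrow> (real \<times> real \<Rightarrow> real) \<Rightarrow> bool"
where
  "classical_shock_solution N1 \<eta> \<tau> \<zeta> chi0 chi1 N0 T chi N \<longleftrightarrow>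
     continuous_on ({0..} \<times> {0..T}) chi \<and>
     Linf_on ({0..} \<times> {0..T}) N \<and>
     (\<exists>g. Linf_loc_on ({0..} \<times> {0..T}) g \<and> has_weak_dt_on chi g ({0..} \<times> {0..T})) \<and>
     (\<exists>\<sigma>. is_shock_front N1 \<eta> \<tau> \<zeta> chi0 chi1 N0 T chi N \<sigma> \<and>
        (\<forall>\<rho>. is_shock_front N1 \<eta> \<tau> \<zeta> chi0 chi1 N0 T chi N \<rho> \<longrightarrow> (\<forall>t\<in>{0..T}. \<rho> t = \<sigma> t)))"

text \<open>
  Equality of pairs (chi, N), the second of which is determined only off the front of the
  first pair.  The front is a null set, so this implies equality of N in \<open>L\<^sup>\<infinity>\<close>.
\<close>

definition same_shock_solution ::
  "real \<Rightarrow> (real \<Rightarrow> real) \<Rightarrow> (real \<times> real \<Rightarrow> real) \<Rightarrow> (real \<times> real \<Rightarrow> real)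
   \<Rightarrow> (real \<times> real \<Rightarrow> real) \<Rightarrow> (real \<times> real \<Rightarrow> real) \<Rightarrow> bool"
where
  "same_shock_solution T \<sigma> chi N chi' N' \<longleftrightarrow>
     (\<forall>s\<ge>0. \<forall>t\<in>{0..T}. chi' (s, t) = chi (s, t) \<and> (s \<noteq> \<sigma> t \<longrightarrow> N' (s, t) = N (s, t)))"

end

theory Submission
  imports Defs
begin

text \<open>
  A front with speed greater than 1 outruns the characteristics, so the exterior solution is given by
  d'Alembert's formula \<open>\<Phi>(s, t) = P(s + t) + Q(s - t)\<close> from data on \<open>s \<ge> \<sigma>\<^sub>0\<close> alone, independently of the
  front.  The condition \<open>\<Phi>(\<sigma>(t), t) = N\<^sub>1 \<sigma>(t)\<close> then determines the front by the implicit function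
  theorem, since \<open>N\<^sub>1 - \<Phi>\<^sub>s > 0\<close>.  Its speed \<open>\<Phi>\<^sub>t / (N\<^sub>1 - \<Phi>\<^sub>s)\<close> exceeds 1 iff
  \<open>\<Phi>\<^sub>s + \<Phi>\<^sub>t = 2 P'(\<sigma> + t) > N\<^sub>1\<close>, which holds for small t by continuity.  The data are extended smoothly
  to the left of \<open>\<sigma>\<^sub>0\<close>, so that \<open>\<Phi>\<close> is \<open>C\<^sup>2\<close> on the whole plane and traces become plain values.
\<close>

section \<open>Traces and regularity up to the boundary\<close>

text \<open>Two difficulties shape the argument. The region ahead of the front is unbounded, so the
  strict bounds \<eta> < \<open>\<Phi>s\<close> < N1 must persist up to one common time for all s;
  the limits of chi0' and chi1' at infinity supply uniform margins. And a competing solution brings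
  a front of its own, with derivatives given inside its own exterior region and merely extended
  continuously to the boundary. The method of characteristics is therefore run in that unknown
  region: the speed condition keeps backward characteristics ahead of the front, and initial values
  of derivatives must be recovered as traces. Once the competitor agrees with \<open>\<Phi>\<close>
  there, both fronts solve the same scalar equation, which has at most one root because
  \<open>\<Phi>s\<close> < N1 on all of s \<ge> \<sigma>0 + t and not only near the front. T can be
  fixed before N0: the initial front is already determined by chi0, whose slope is N1 behind it and
  less than N1 ahead of it.\<close>

lemma at_within_interior_neq_bot:
  fixes p :: "'a::{perfect_space,t2_space}"
  assumes "p \<in> closure (interior R)"
  shows "at p within interior R \<noteq> bot"
proof -
  have "p islimpt interior R"
  proof (cases "p \<in> interior R")
    case True
    then have "p islimpt UNIV \<inter> interior R"
      by (metis Int_UNIV_left interior_interior interior_limit_point)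
    then show ?thesis by simp
  next
    case False
    then show ?thesis using assms by (auto simp: closure_def)
  qed
  then show ?thesis using trivial_limit_within by blast
qed

text \<open>No limit is required to exist: both functions have exactly the same limits at p, so
  \<open>Lim\<close> selects the same value even in the degenerate case.\<close>

lemma trace_cong:
  assumes "\<And>p. p \<in> interior R \<Longrightarrow> f p = g p"
  shows "trace R f = trace R g"
proof
  fix p
  have "(f \<longlongrightarrow> l) (at p within interior R) \<longleftrightarrow> (g \<longlongrightarrow> l) (at p within interior R)" for l
    by (rule filterlim_cong) (auto simp: eventually_at_filter assms)
  then show "trace R f p = trace R g p" by (simp add: trace_def Topological_Spaces.Lim_def)
qed

text \<open>The closure hypothesis makes the filter nontrivial, hence the limit unique, and
  continuity of \<open>F\<close> up to the boundary gives its value. Nothing is asked of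
  \<open>f\<close> on the boundary, where the tension of a solution is left free.\<close>

lemma trace_eqI:
  fixes p :: "'a::{perfect_space,t2_space}"
  assumes "R \<subseteq> closure (interior R)" "continuous_on R F" "p \<in> R"
    and "\<And>q. q \<in> interior R \<Longrightarrow> f q = F q"
  shows "trace R f p = F p"
proof -
  have "trace R f p = trace R F p" using trace_cong[of R f F] assms(4) by metis
  also have "\<dots> = F p"
    unfolding trace_def
  proof (rule tendsto_Lim)
    show "at p within interior R \<noteq> bot" using assms by (intro at_within_interior_neq_bot) auto
    show "(F \<longlongrightarrow> F p) (at p within interior R)"
      using assms(2,3) interior_subset tendsto_within_subset unfolding continuous_on_def by blast
  qed
  finally show ?thesis .
qed

text \<open>By \<open>trace_eqI\<close> every continuous extension coincides with the trace on
  \<open>R\<close>, so the extension assumed to exist may be taken to be the trace itself.\<close>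

lemma
  fixes R :: "'a::{perfect_space,t2_space} set"
  assumes "extends_cont R f" "R \<subseteq> closure (interior R)"
  shows continuous_on_trace: "continuous_on R (trace R f)"
    and trace_interior: "p \<in> interior R \<Longrightarrow> trace R f p = f p"
proof -
  obtain F where F: "continuous_on R F" "\<And>q. q \<in> interior R \<Longrightarrow> F q = f q"
    using assms(1) by (auto simp: extends_cont_def)
  have *: "trace R f q = F q" if "q \<in> R" for q
    using trace_eqI[OF assms(2) F(1) that, of f] F(2) by simp
  show "continuous_on R (trace R f)" by (rule continuous_on_eq[OF F(1)]) (simp add: *)
  show "trace R f p = f p" if "p \<in> interior R" using *[OF subsetD[OF interior_subset that]] F(2)[OF that] by simp
qed

lemma extends_contI:
  assumes "continuous_on R F" "\<And>q. q \<in> interior R \<Longrightarrow> f q = F q"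
  shows "extends_cont R f"
  using assms by (auto simp: extends_cont_def intro!: exI[of _ F])

lemma rlim_eqI:
  assumes "(G \<longlongrightarrow> l) (at_right a)" "\<And>x. a < x \<Longrightarrow> g x = G x"
  shows "rlim g a = l"
proof -
  have "(g \<longlongrightarrow> l) (at_right a)"
    using assms(1) by (rule Lim_transform_eventually) (auto simp: eventually_at_filter assms(2))
  then show ?thesis unfolding rlim_def by (intro tendsto_Lim) auto
qed

lemma has_field_derivative_cong_open:
  assumes "open U" "x \<in> U" "\<And>y. y \<in> U \<Longrightarrow> f y = g y" "(f has_field_derivative D) (at x)"
  shows "(g has_field_derivative D) (at x)"
proof -
  have "\<forall>\<^sub>F y in nhds x. f y = g y"
    using assms(1-3) by (auto simp: eventually_nhds)
  then show ?thesis using DERIV_cong_ev[of x x f g D D] assms(4) by simp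
qed

section \<open>Locality of derivatives and of C^k regularity\<close>

lemma open_slices:
  fixes U :: "(real \<times> real) set"
  assumes "open U"
  shows "open {x. (x, t) \<in> U}" "open {y. (s, y) \<in> U}"
  using open_vimage[OF assms, of "\<lambda>x. (x, t)"] open_vimage[OF assms, of "\<lambda>y. (s, y)"]
  by (simp_all add: vimage_def continuous_intros)

lemma has_partial_cong:
  fixes U :: "(real \<times> real) set"
  assumes "open U" "(s, t) \<in> U" "\<And>p. p \<in> U \<Longrightarrow> f p = g p"
  shows "((\<lambda>x. f (x, t)) has_field_derivative D) (at s) \<longleftrightarrow> ((\<lambda>x. g (x, t)) has_field_derivative D) (at s)"
    and "((\<lambda>y. f (s, y)) has_field_derivative D) (at t) \<longleftrightarrow> ((\<lambda>y. g (s, y)) has_field_derivative D) (at t)"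
  using has_field_derivative_cong_open[OF open_slices(1)[OF assms(1), of t], of s]
    has_field_derivative_cong_open[OF open_slices(2)[OF assms(1), of s], of t] assms(2,3)
  by (smt (verit, best) mem_Collect_eq)+

lemma Ck_line_cong:
  assumes "\<And>x. x \<in> interior R \<Longrightarrow> f x = g x"
  shows "Ck_line k R f \<longleftrightarrow> Ck_line k R g"
  using assms
proof (induction k arbitrary: f g)
  case 0
  then show ?case by (simp add: extends_cont_def)
next
  case (Suc k)
  have D: "(f has_field_derivative D) (at x) \<longleftrightarrow> (g has_field_derivative D) (at x)"
    if "x \<in> interior R" for x D
    using has_field_derivative_cong_open[OF open_interior that] Suc.prems by metis
  then have "deriv f x = deriv g x" if "x \<in> interior R" for x
    using that by (simp add: deriv_def)
  from Suc.IH[OF this] D Suc.prems show ?case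
    by (simp add: extends_cont_def field_differentiable_def)
qed

text \<open>The definition recurses through \<open>deriv f\<close>; this rule allows each derivative
  to be named explicitly instead.\<close>

lemma Ck_line_SucI:
  assumes "continuous_on R F" "\<And>x. x \<in> interior R \<Longrightarrow> f x = F x"
    and "\<And>x. x \<in> interior R \<Longrightarrow> (F has_field_derivative F' x) (at x)" "Ck_line k R F'"
  shows "Ck_line (Suc k) R f"
proof -
  have "Ck_line (Suc k) R F"
    using assms(1,3,4) Ck_line_cong[of R "deriv F" F' k]
    by (auto simp: DERIV_imp_deriv field_differentiable_def intro: extends_contI)
  then show ?thesis using Ck_line_cong[of R f F "Suc k"] assms(2) by blast
qed

lemma partials_cong:
  assumes "\<And>p. p \<in> interior R \<Longrightarrow> f p = g p" "p \<in> interior R"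
  shows "ds f p = ds g p" "dt f p = dt g p"
proof -
  obtain s t where p: "p = (s, t)" by fastforce
  show "ds f p = ds g p" "dt f p = dt g p"
    using has_partial_cong[OF open_interior assms(2)[unfolded p], of f g] assms(1)
    by (simp_all add: p ds_def dt_def deriv_def)
qed

text \<open>The interior is open, so agreement there passes to partial derivatives and hence to all
  orders. Thus \<open>chi\<close> and \<open>N\<close>, glued from two formulas along the front, can
  be exchanged for the smooth exterior formula.\<close>

lemma Ck_plane_cong:
  assumes "\<And>p. p \<in> interior R \<Longrightarrow> f p = g p"
  shows "Ck_plane k R f \<longleftrightarrow> Ck_plane k R g"
  using assms
proof (induction k arbitrary: f g)
  case 0
  then show ?case by (simp add: extends_cont_def)
next
  case (Suc k)
  note D = has_partial_cong[OF open_interior, where f=f and g=g, OF _ Suc.prems]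
  have ex: "((\<lambda>x. f (x, t)) field_differentiable at s) \<longleftrightarrow> ((\<lambda>x. g (x, t)) field_differentiable at s)"
    "((\<lambda>y. f (s, y)) field_differentiable at t) \<longleftrightarrow> ((\<lambda>y. g (s, y)) field_differentiable at t)"
    if "(s, t) \<in> interior R" for s t
    using D[OF that] by (simp_all add: field_differentiable_def)
  note I = Suc.IH[OF partials_cong(1)[OF Suc.prems]] Suc.IH[OF partials_cong(2)[OF Suc.prems]]
  show ?case
    using I ex Suc.prems by (simp add: extends_cont_def Ball_def)
qed

lemma Ck_plane_SucI:
  assumes "continuous_on R F" "\<And>p. p \<in> interior R \<Longrightarrow> f p = F p"
    and "\<And>s t. (s, t) \<in> interior R \<Longrightarrow> ((\<lambda>x. F (x, t)) has_field_derivative Fs (s, t)) (at s)"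
    and "\<And>s t. (s, t) \<in> interior R \<Longrightarrow> ((\<lambda>y. F (s, y)) has_field_derivative Ft (s, t)) (at t)"
    and "Ck_plane k R Fs" "Ck_plane k R Ft"
  shows "Ck_plane (Suc k) R f"
proof -
  have "ds F p = Fs p" "dt F p = Ft p" if "p \<in> interior R" for p
    using that assms(3,4)[of "fst p" "snd p"] by (auto simp: ds_def dt_def split_beta DERIV_imp_deriv)
  then have "Ck_plane k R (ds F)" "Ck_plane k R (dt F)"
    using Ck_plane_cong[of R "ds F" Fs k] Ck_plane_cong[of R "dt F" Ft k] assms(5,6) by auto
  moreover have "(\<lambda>x. F (x, t)) field_differentiable at s" "(\<lambda>y. F (s, y)) field_differentiable at t"
    if "(s, t) \<in> interior R" for s t
    using assms(3,4)[OF that] unfolding field_differentiable_def by blast+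
  ultimately have "Ck_plane (Suc k) R F"
    using assms(1) by (auto intro: extends_contI)
  then show ?thesis using Ck_plane_cong[of R f F "Suc k"] assms(2) by blast
qed

lemma Ck_plane_imp_extends_cont: "Ck_plane k R f \<Longrightarrow> extends_cont R f"
  by (cases k) auto

lemma Ck_line_DERIV:
  "Ck_line (Suc k) R f \<Longrightarrow> x \<in> interior R \<Longrightarrow> (f has_field_derivative deriv f x) (at x)"
  by (simp add: DERIV_deriv_iff_field_differentiable)

lemma Ck_plane_DERIV:
  assumes "Ck_plane (Suc k) R f" "(s, t) \<in> interior R"
  shows "((\<lambda>x. f (x, t)) has_field_derivative ds f (s, t)) (at s)"
    and "((\<lambda>y. f (s, y)) has_field_derivative dt f (s, t)) (at t)"
  using assms by (auto simp: ds_def dt_def DERIV_deriv_iff_field_differentiable)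

lemma atLeast_subset_closure: "{a..} \<subseteq> closure (interior {a..})" for a :: real
  by simp

lemma Icc_subset_closure: "0 < T \<Longrightarrow> {0..T} \<subseteq> closure (interior {0..T})" for T :: real
  by simp

section \<open>Geometry of the region ahead of the front\<close>

lemma interior_ext_region:
  assumes "continuous_on {0..T} \<sigma>"
  shows "interior (ext_region T \<sigma>) = {(s, t). 0 < t \<and> t < T \<and> \<sigma> t < s}" (is "_ = ?U")
proof (rule interior_unique)
  show "?U \<subseteq> ext_region T \<sigma>" by (auto simp: ext_region_def)
  show "open ?U"
  proof -
    have c: "continuous_on (UNIV \<times> {0<..<T}) (\<lambda>p. fst p - \<sigma> (snd p))"
      by (intro continuous_intros continuous_on_compose2[OF assms]) auto
    have "open ((\<lambda>p. fst p - \<sigma> (snd p)) -` {0<..} \<inter> (UNIV \<times> {0<..<T}))"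
      using continuous_open_preimage[OF c] by (simp add: Int_commute open_Times)
    also have "(\<lambda>p. fst p - \<sigma> (snd p)) -` {0<..} \<inter> (UNIV \<times> {0<..<T}) = ?U" by auto
    finally show ?thesis .
  qed
  fix S assume S: "S \<subseteq> ext_region T \<sigma>" "open S"
  show "S \<subseteq> ?U"
  proof clarify
    fix s t assume "(s, t) \<in> S"
    then obtain e where e: "e > 0" "ball (s, t) e \<subseteq> S" using S(2) openE by blast
    \<comment> \<open>The shift to the left excludes points on the front; the two shifts in time
      exclude t = 0 and t = T.\<close>
    then have "(s - e/2, t) \<in> S" "(s, t - e/2) \<in> S" "(s, t + e/2) \<in> S"
      by (auto intro!: subsetD[OF e(2)] simp: dist_Pair_Pair dist_real_def)
    then show "0 < t \<and> t < T \<and> \<sigma> t < s" using S(1) e(1) by (force simp: ext_region_def)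
  qed
qed

text \<open>The front is merely continuous, so a straight segment from a boundary point could leave
  the region. The path used here follows the front instead: its time \<open>c e\<close> moves
  towards T/2, its distance ahead of the front stays s - \<sigma> t, and the added \<open>e\<close>
  makes that distance positive.\<close>

lemma ext_region_subset_closure:
  assumes "continuous_on {0..T} \<sigma>" "0 < T"
  shows "ext_region T \<sigma> \<subseteq> closure (interior (ext_region T \<sigma>))"
proof clarify
  fix s t assume st: "(s, t) \<in> ext_region T \<sigma>"
  define c where "c = (\<lambda>e. t + e * (T/2 - t))"
  have t: "0 \<le> t" "t \<le> T" and s: "\<sigma> t \<le> s" using st by (auto simp: ext_region_def)
  have ce: "0 < c e \<and> c e < T" if "0 < e" "e < 1" for e
  proof -
    have "c e = (1 - e) * t + e * (T/2)" by (simp add: c_def algebra_simps)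
    moreover have "0 \<le> (1 - e) * t" "(1 - e) * t \<le> (1 - e) * T" "0 < e * (T/2)" "e * (T/2) < e * T"
      using that t assms(2) by (auto intro: mult_left_mono)
    ultimately show ?thesis by (auto simp: algebra_simps)
  qed
  have c: "continuous_on {0..1} c" unfolding c_def by (intro continuous_intros)
  have "continuous_on {0..1} (\<lambda>e. \<sigma> (c e))"
  proof (rule continuous_on_compose2[OF assms(1) c])
    have "c e \<in> {0..T}" if "e \<in> {0..1}" for e
      using that ce[of e] t assms(2) by (cases "e = 0 \<or> e = 1") (auto simp: c_def less_imp_le)
    then show "c ` {0..1} \<subseteq> {0..T}" by auto
  qed
  then have "continuous_on {0..1} (\<lambda>e. (\<sigma> (c e) + (s - \<sigma> t) + e, c e))"
    using c by (intro continuous_intros)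
  then have "((\<lambda>e. (\<sigma> (c e) + (s - \<sigma> t) + e, c e)) \<longlongrightarrow> (s, t)) (at 0 within {0..1})"
    unfolding continuous_on_def by (force simp: c_def)
  then have lim: "((\<lambda>e. (\<sigma> (c e) + (s - \<sigma> t) + e, c e)) \<longlongrightarrow> (s, t)) (at 0 within {0<..<1})"
    by (rule tendsto_within_subset) auto
  show "(s, t) \<in> closure (interior (ext_region T \<sigma>))"
  proof (rule Lim_in_closed_set[OF closed_closure _ _ lim])
    show "\<forall>\<^sub>F e in at 0 within {0<..<1}. (\<sigma> (c e) + (s - \<sigma> t) + e, c e) \<in> closure (interior (ext_region T \<sigma>))"
      unfolding eventually_at_filter
      using ce s by (intro always_eventually allI impI subsetD[OF closure_subset])
        (auto simp: interior_ext_region[OF assms(1)])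
    show "at 0 within {0<..<1::real} \<noteq> bot"
      using trivial_limit_within islimpt_greaterThanLessThan1[of 0 "1::real"] by auto
  qed
qed

lemma mvt_between:
  fixes f :: "real \<Rightarrow> real"
  assumes "\<And>x. min a b \<le> x \<Longrightarrow> x \<le> max a b \<Longrightarrow> (f has_real_derivative f' x) (at x)"
  obtains z where "min a b \<le> z" "z \<le> max a b" "f b - f a = (b - a) * f' z"
proof -
  consider "a < b" | "a = b" | "b < a" by linarith
  then show ?thesis
  proof cases
    case 1
    then obtain z where "a < z" "z < b" "f b - f a = (b - a) * f' z"
      using MVT2[of a b f f'] assms by auto
    then show ?thesis using that[of z] by auto
  next
    case 2
    then show ?thesis using that[of a] by auto
  next
    case 3
    then obtain z where "b < z" "z < a" "f a - f b = (a - b) * f' z"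
      using MVT2[of b a f f'] assms by auto
    then show ?thesis using that[of z] by (auto simp: algebra_simps)
  qed
qed

section \<open>The wave equation ahead of a supersonic front\<close>

text \<open>Regularity is defined through partial derivatives, but the chain rule along
  characteristics needs a total derivative. Continuity of the partial in t suffices, by a mean value
  argument in that direction.\<close>

lemma has_derivative_of_partials:
  fixes F Fs Ft :: "real \<times> real \<Rightarrow> real"
  assumes U: "open U" "(s, t) \<in> U"
    and Fs: "((\<lambda>x. F (x, t)) has_real_derivative Fs (s, t)) (at s)"
    and Ft: "\<And>x y. (x, y) \<in> U \<Longrightarrow> ((\<lambda>y. F (x, y)) has_real_derivative Ft (x, y)) (at y)"
    and cont: "continuous_on U Ft"
  shows "(F has_derivative (\<lambda>(h, k). Fs (s, t) * h + Ft (s, t) * k)) (at (s, t))"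
proof -
  obtain A B where AB: "open A" "open B" "(s, t) \<in> A \<times> B" "A \<times> B \<subseteq> U"
    using open_prod_elim[OF U] by blast
  \<comment> \<open>The second factor is shrunk to a ball because the mean value argument in t takes
    place in a convex set.\<close>
  then obtain e where e: "e > 0" "ball t e \<subseteq> B" using openE[of B t] by auto
  let ?Y = "ball t e"
  have sub: "A \<times> ?Y \<subseteq> U" using AB(4) e(2) by blast
  have "((\<lambda>(x, y). F (x, y)) has_derivative
      (\<lambda>(h, k). Fs (s, t) * h + blinfun_apply (blinfun_mult_right (Ft (s, t))) k)) (at (s, t) within A \<times> ?Y)"
  proof (rule has_derivative_partialsI)
    show "((\<lambda>x. F (x, t)) has_derivative (\<lambda>h. Fs (s, t) * h)) (at s within A)"
      using Fs by (auto simp: has_field_derivative_def intro: has_derivative_at_withinI)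
    show "((\<lambda>y. F (x, y)) has_derivative blinfun_apply (blinfun_mult_right (Ft (x, y)))) (at y within ?Y)"
      if "x \<in> A" "y \<in> ?Y" for x y
    proof (rule has_derivative_at_withinI)
      have "(x, y) \<in> U" using sub that by blast
      then show "((\<lambda>y. F (x, y)) has_derivative blinfun_apply (blinfun_mult_right (Ft (x, y)))) (at y)"
        using Ft[of x y] by (simp add: has_field_derivative_def blinfun_mult_right.rep_eq)
    qed
    have "continuous_on (A \<times> ?Y) (\<lambda>p. blinfun_mult_right (Ft p))"
      using continuous_on_subset[OF cont sub] by (rule bounded_linear.continuous_on[OF bounded_linear_blinfun_mult_right])
    then show "continuous (at (s, t) within A \<times> ?Y) (\<lambda>(x, y). blinfun_mult_right (Ft (x, y)))"
      using AB(3) e(1) by (simp add: continuous_on_eq_continuous_within case_prod_unfold)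
  qed (use e(1) in auto)
  moreover have "at (s, t) within A \<times> ?Y = at (s, t)"
    using AB e(1) by (intro at_within_open open_Times) auto
  ultimately show ?thesis by simp
qed

text \<open>Schwarz's theorem by the second difference of F over a small square of side h: two mean
  values, taken first in s or first in t, write it as h^2 \<open>Fst\<close> at one point of the
  square and as h^2 \<open>Fts\<close> at another. Different mixed partials at (a, b) would by
  continuity keep these values apart.\<close>

lemma mixed_partials_eq:
  fixes F Fs Ft Fst Fts :: "real \<times> real \<Rightarrow> real"
  assumes U: "open U" "(a, b) \<in> U"
    and Fs: "\<And>x y. (x, y) \<in> U \<Longrightarrow> ((\<lambda>x. F (x, y)) has_real_derivative Fs (x, y)) (at x)"
    and Ft: "\<And>x y. (x, y) \<in> U \<Longrightarrow> ((\<lambda>y. F (x, y)) has_real_derivative Ft (x, y)) (at y)"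
    and Fst: "\<And>x y. (x, y) \<in> U \<Longrightarrow> ((\<lambda>y. Fs (x, y)) has_real_derivative Fst (x, y)) (at y)"
    and Fts: "\<And>x y. (x, y) \<in> U \<Longrightarrow> ((\<lambda>x. Ft (x, y)) has_real_derivative Fts (x, y)) (at x)"
    and cont: "continuous_on U Fst" "continuous_on U Fts"
  shows "Fst (a, b) = Fts (a, b)"
proof (rule ccontr)
  assume ne: "Fst (a, b) \<noteq> Fts (a, b)"
  \<comment> \<open>Half the gap, so that two errors below \<open>e\<close> cannot bridge
    it.\<close>
  define e where "e = \<bar>Fst (a, b) - Fts (a, b)\<bar> / 2"
  have e: "e > 0" using ne by (simp add: e_def)
  have "\<forall>\<^sub>F p in nhds (a, b). \<bar>Fst p - Fst (a, b)\<bar> < e" "\<forall>\<^sub>F p in nhds (a, b). \<bar>Fts p - Fts (a, b)\<bar> < e"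
    using cont U e by (auto simp: continuous_on_eq_continuous_at continuous_at_eps_delta
        isCont_def dist_real_def tendsto_iff eventually_at eventually_nhds_metric)
  then have "\<forall>\<^sub>F p in nhds (a, b). \<bar>Fst p - Fst (a, b)\<bar> < e \<and> \<bar>Fts p - Fts (a, b)\<bar> < e \<and> p \<in> U"
    using eventually_nhds_in_open[OF U] by (auto intro: eventually_conj)
  then obtain V where V: "open V" "(a, b) \<in> V"
    and Ve: "\<And>p. p \<in> V \<Longrightarrow> \<bar>Fst p - Fst (a, b)\<bar> < e \<and> \<bar>Fts p - Fts (a, b)\<bar> < e \<and> p \<in> U"
    unfolding eventually_nhds by blast
  obtain A B where AB: "open A" "open B" "(a, b) \<in> A \<times> B" "A \<times> B \<subseteq> V"
    using open_prod_elim[OF V] by blast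
  obtain h1 where h1: "h1 > 0" "cball a h1 \<subseteq> A" using AB open_contains_cball by blast
  obtain h2 where h2: "h2 > 0" "cball b h2 \<subseteq> B" using AB open_contains_cball by blast
  define h where "h = min h1 h2"
  have h: "h > 0" using h1 h2 by (simp add: h_def)
  have box: "(x, y) \<in> V" if "a \<le> x" "x \<le> a + h" "b \<le> y" "y \<le> b + h" for x y
  proof -
    have "x \<in> cball a h1" "y \<in> cball b h2" using that by (auto simp: h_def dist_real_def)
    then show ?thesis using h1 h2 AB(4) by blast
  qed
  then have boxU: "(x, y) \<in> U" if "a \<le> x" "x \<le> a + h" "b \<le> y" "y \<le> b + h" for x y
    using that Ve by blast
  have "\<exists>z. a < z \<and> z < a + h \<and> (F (a + h, b + h) - F (a + h, b)) - (F (a, b + h) - F (a, b))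
      = (a + h - a) * (Fs (z, b + h) - Fs (z, b))"
    using h by (intro MVT2 DERIV_diff Fs boxU) auto
  then obtain x where x: "a < x" "x < a + h" and D1: "(F (a + h, b + h) - F (a + h, b)) - (F (a, b + h) - F (a, b))
      = h * (Fs (x, b + h) - Fs (x, b))" by auto
  have "\<exists>z. b < z \<and> z < b + h \<and> Fs (x, b + h) - Fs (x, b) = (b + h - b) * Fst (x, z)"
    using h x by (intro MVT2 Fst boxU) auto
  then obtain y where y: "b < y" "y < b + h" "Fs (x, b + h) - Fs (x, b) = h * Fst (x, y)" by auto
  have "\<exists>z. b < z \<and> z < b + h \<and> (F (a + h, b + h) - F (a, b + h)) - (F (a + h, b) - F (a, b))
      = (b + h - b) * (Ft (a + h, z) - Ft (a, z))"
    using h by (intro MVT2 DERIV_diff Ft boxU) auto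
  then obtain y' where y': "b < y'" "y' < b + h" and D2: "(F (a + h, b + h) - F (a, b + h)) - (F (a + h, b) - F (a, b))
      = h * (Ft (a + h, y') - Ft (a, y'))" by auto
  have "\<exists>z. a < z \<and> z < a + h \<and> Ft (a + h, y') - Ft (a, y') = (a + h - a) * Fts (z, y')"
    using h y' by (intro MVT2 Fts boxU) auto
  then obtain x' where x': "a < x'" "x' < a + h" "Ft (a + h, y') - Ft (a, y') = h * Fts (x', y')" by auto
  have "h * (h * Fst (x, y)) = h * (h * Fts (x', y'))" unfolding y(3)[symmetric] x'(3)[symmetric] using D1 D2 by linarith
  then have "Fst (x, y) = Fts (x', y')" using h by simp
  moreover have "\<bar>Fst (x, y) - Fst (a, b)\<bar> < e" "\<bar>Fts (x', y') - Fts (a, b)\<bar> < e"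
    using Ve[OF box[of x y]] Ve[OF box[of x' y']] x y x' y' by auto
  moreover have "\<bar>u - v\<bar> \<le> \<bar>z - u\<bar> + \<bar>z - v\<bar>" for u v z :: real by arith
  from this[of "Fst (a, b)" "Fts (a, b)" "Fst (x, y)"] have "2 * e \<le> \<bar>Fst (x, y) - Fst (a, b)\<bar> + \<bar>Fst (x, y) - Fts (a, b)\<bar>"
    by (simp add: e_def)
  ultimately show False by simp
qed

section \<open>D'Alembert waves and uniqueness for the wave equation\<close>

definition wave :: "(real \<Rightarrow> real) \<Rightarrow> (real \<Rightarrow> real) \<Rightarrow> real \<times> real \<Rightarrow> real" where
  "wave P Q = (\<lambda>(s, t). P (s + t) + Q (s - t))"

lemma wave_apply: "wave P Q (s, t) = P (s + t) + Q (s - t)"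
  by (simp add: wave_def)

lemma continuous_on_wave:
  assumes "continuous_on UNIV P" "continuous_on UNIV Q"
  shows "continuous_on S (wave P Q)"
  unfolding wave_def split_beta
  by (intro continuous_intros continuous_on_compose2[OF assms(1)] continuous_on_compose2[OF assms(2)]) auto

text \<open>Partial derivatives of a wave are again waves, of the differentiated profiles, with the
  sign of the right-moving part reversed in t. Two applications give the same wave for both pure
  second derivatives, which is the wave equation.\<close>

lemma
  assumes P: "\<And>x. (P has_real_derivative P' x) (at x)" and Q: "\<And>x. (Q has_real_derivative Q' x) (at x)"
  shows DERIV_wave_s: "((\<lambda>x. wave P Q (x, t)) has_real_derivative wave P' Q' (s, t)) (at s)"
    and DERIV_wave_t: "((\<lambda>y. wave P Q (s, y)) has_real_derivative wave P' (\<lambda>x. - Q' x) (s, t)) (at t)"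
proof -
  have 1: "((\<lambda>x. P (x + t)) has_real_derivative P' (s + t)) (at s)"
    "((\<lambda>x. Q (x - t)) has_real_derivative Q' (s - t)) (at s)"
    "((\<lambda>y. P (s + y)) has_real_derivative P' (s + t)) (at t)"
    using P[of "s + t"] Q[of "s - t"] DERIV_shift[of P _ s t] DERIV_shift[of Q _ s "-t"]
      DERIV_shift[of P _ t s] by (simp_all add: add.commute)
  have 2: "((\<lambda>y. Q (s - y)) has_real_derivative - Q' (s - t)) (at t)"
    using DERIV_chain2[OF Q, of "\<lambda>y. s - y" "-1" t UNIV] DERIV_diff[OF DERIV_const DERIV_ident, of s t UNIV]
    by simp
  show "((\<lambda>x. wave P Q (x, t)) has_real_derivative wave P' Q' (s, t)) (at s)"
    "((\<lambda>y. wave P Q (s, y)) has_real_derivative wave P' (\<lambda>x. - Q' x) (s, t)) (at t)"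
    unfolding wave_apply by (intro DERIV_add 1 2)+
qed

text \<open>
  By the hypothesis \<open>fast\<close>, both backward characteristics from a point of E stay in E down to \<open>t = 0\<close>;
  \<open>w\<^sub>s \<plusminus> w\<^sub>t\<close> are constant along them.
\<close>

lemma wave_unique:
  fixes w :: "real \<times> real \<Rightarrow> real" and T :: real and \<rho> :: "real \<Rightarrow> real"
  defines "E \<equiv> ext_region T \<rho>"
  assumes T: "0 < T" and \<rho>: "continuous_on {0..T} \<rho>"
    and fast: "\<And>y t. 0 \<le> y \<Longrightarrow> y < t \<Longrightarrow> t \<le> T \<Longrightarrow> \<rho> y + (t - y) < \<rho> t"
    and C2: "Ck_plane 2 E w" and w: "continuous_on E w"
    and eq: "\<And>p. p \<in> E \<Longrightarrow> trace E (dt (dt w)) p = trace E (ds (ds w)) p"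
    and w0: "\<And>s. \<rho> 0 \<le> s \<Longrightarrow> w (s, 0) = P s + Q s"
    and w1: "\<And>s. \<rho> 0 \<le> s \<Longrightarrow> trace E (dt w) (s, 0) = P1 s - Q1 s"
    and P: "\<And>x. (P has_real_derivative P1 x) (at x)" and Q: "\<And>x. (Q has_real_derivative Q1 x) (at x)"
    and P1: "continuous_on UNIV P1" and Q1: "continuous_on UNIV Q1"
    and p: "p \<in> E"
  shows "w p = wave P Q p"
proof -
  have int: "interior E = {(s, t). 0 < t \<and> t < T \<and> \<rho> t < s}"
    unfolding E_def by (rule interior_ext_region[OF \<rho>])
  have cl: "E \<subseteq> closure (interior E)" unfolding E_def by (rule ext_region_subset_closure[OF \<rho> T])
  have C: "Ck_plane (Suc (Suc 0)) E w" "Ck_plane (Suc 0) E (ds w)" "Ck_plane (Suc 0) E (dt w)"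
    "Ck_plane 0 E (ds (ds w))" "Ck_plane 0 E (dt (ds w))" "Ck_plane 0 E (ds (dt w))" "Ck_plane 0 E (dt (dt w))"
    using C2 by (auto simp: numeral_2_eq_2)
  define ws where "ws = trace E (ds w)"
  define wt where "wt = trace E (dt w)"
  note ext = C[THEN Ck_plane_imp_extends_cont]
  have ws: "continuous_on E ws" "\<And>p. p \<in> interior E \<Longrightarrow> ws p = ds w p"
    unfolding ws_def using continuous_on_trace[OF ext(2) cl] trace_interior[OF ext(2) cl] by auto
  have wt: "continuous_on E wt" "\<And>p. p \<in> interior E \<Longrightarrow> wt p = dt w p"
    unfolding wt_def using continuous_on_trace[OF ext(3) cl] trace_interior[OF ext(3) cl] by auto
  have c2: "continuous_on (interior E) f" if "Ck_plane 0 E f" for f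
    using continuous_on_subset[OF continuous_on_trace[OF that[THEN Ck_plane_imp_extends_cont] cl] interior_subset]
      trace_interior[OF that[THEN Ck_plane_imp_extends_cont] cl]
    by (rule continuous_on_eq)
  have fast': "\<rho> y + (t - y) \<le> \<rho> t" if "0 \<le> y" "y \<le> t" "t \<le> T" for y t
    using fast[of y t] that by (cases "y = t") auto

  \<comment> \<open>The trace of \<open>w\<^sub>s\<close> on \<open>t = 0\<close> is the derivative of the trace of w; otherwise
    the mean value theorem on nearby horizontal segments contradicts continuity of w.\<close>
  have ws0: "ws (s, 0) = P1 s + Q1 s" if s: "\<rho> 0 < s" for s
  proof (rule ccontr)
    assume ne: "ws (s, 0) \<noteq> P1 s + Q1 s"
    define h where "h = (\<lambda>p. ws p - (P1 (fst p) + Q1 (fst p)))"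
    have hc: "continuous_on E h" unfolding h_def
      by (intro continuous_intros ws continuous_on_compose2[OF P1] continuous_on_compose2[OF Q1]) auto
    define c where "c = \<bar>h (s, 0)\<bar> / 2"
    have c: "c > 0" using ne by (simp add: c_def h_def)
    have s0E: "(s, 0) \<in> E" using T s by (simp add: E_def ext_region_def)
    obtain d where d: "d > 0" "\<And>q. q \<in> E \<Longrightarrow> dist q (s, 0) < d \<Longrightarrow> \<bar>h q - h (s, 0)\<bar> < c"
      using hc s0E c unfolding continuous_on_iff dist_real_def by metis
    obtain d' where d': "d' > 0" "\<And>t. t \<in> {0..T} \<Longrightarrow> \<bar>t - 0\<bar> < d' \<Longrightarrow> \<bar>\<rho> t - \<rho> 0\<bar> < s - \<rho> 0"
      using \<rho> T s unfolding continuous_on_iff dist_real_def by (metis atLeastAtMost_iff diff_gt_0_iff_gt less_eq_real_def)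
    define r where "r = d / 3"
    define y0 where "y0 = min (T / 2) (min (d' / 2) r)"
    have r: "r > 0" and y0: "y0 > 0" "y0 < T" "y0 < d'" "y0 \<le> r"
      using d d' T by (auto simp: r_def y0_def)
    \<comment> \<open>Up to time \<open>y0\<close> the front moves by less than s - \<rho> 0, so
      everything from \<open>s\<close> to the right stays ahead of it.\<close>
    have inE: "(x, y) \<in> interior E" if "s \<le> x" "0 < y" "y \<le> y0" for x y
      using that d'(2)[of y] y0 by (auto simp: int)
    have hb: "c < \<bar>h (x, y)\<bar>" if "s \<le> x" "x \<le> s + r" "0 < y" "y \<le> y0" for x y
    proof -
      have "dist (x, y) (s, 0) \<le> \<bar>x - s\<bar> + \<bar>y\<bar>"
        by (simp add: dist_Pair_Pair dist_real_def sqrt_sum_squares_le_sum_abs)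
      also have "\<dots> \<le> 2 * r" using that y0 by auto
      also have "\<dots> < d" using d by (simp add: r_def)
      finally have "\<bar>h (x, y) - h (s, 0)\<bar> < c"
        using d(2) inE[OF that(1,3,4)] interior_subset by blast
      then show ?thesis unfolding c_def by linarith
    qed
    define f where "f = (\<lambda>x y. w (x, y) - (P x + Q x))"
    have fb: "r * c \<le> \<bar>f (s + r) y - f s y\<bar>" if y: "0 < y" "y \<le> y0" for y
    proof -
      have "((\<lambda>x. f x y) has_real_derivative h (x, y)) (at x)" if "s \<le> x" "x \<le> s + r" for x
        unfolding f_def h_def using ws(2)[OF inE[OF that(1) y]] Ck_plane_DERIV(1)[OF C(1) inE[OF that(1) y]]
        by (auto intro!: DERIV_diff DERIV_add P Q)
      then obtain z where z: "s < z" "z < s + r" "f (s + r) y - f s y = (s + r - s) * h (z, y)"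
        using MVT2[of s "s + r" "\<lambda>x. f x y" "\<lambda>x. h (x, y)"] r by auto
      then show ?thesis using hb[of z y] y r by (simp add: abs_mult)
    qed
    have lim: "((\<lambda>y. f x y) \<longlongrightarrow> 0) (at 0 within {0<..<y0})" if "s \<le> x" for x
    proof -
      have "continuous_on {0..y0} (\<lambda>y. w (x, y))"
      proof (rule continuous_on_compose2[OF w])
        have "(x, y) \<in> E" if "y \<in> {0..y0}" for y
          using inE[OF \<open>s \<le> x\<close>, of y] that interior_subset \<open>s \<le> x\<close> s T
          by (cases "y = 0") (auto simp: E_def ext_region_def)
        then show "Pair x ` {0..y0} \<subseteq> E" by auto
      qed (intro continuous_intros)
      then have "((\<lambda>y. w (x, y)) \<longlongrightarrow> P x + Q x) (at 0 within {0..y0})"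
        using w0[of x] that s y0 unfolding continuous_on_def by force
      then have "((\<lambda>y. w (x, y)) \<longlongrightarrow> P x + Q x) (at 0 within {0<..<y0})"
        by (rule tendsto_within_subset) auto
      from tendsto_diff[OF this tendsto_const[of "P x + Q x"]] show ?thesis by (simp add: f_def)
    qed
    have "((\<lambda>y. \<bar>f (s + r) y - f s y\<bar>) \<longlongrightarrow> 0) (at 0 within {0<..<y0})"
      using tendsto_rabs[OF tendsto_diff[OF lim lim, of "s + r" s]] r by simp
    moreover have "at 0 within {0<..<y0} \<noteq> bot"
      using y0 by (simp add: trivial_limit_within islimpt_greaterThanLessThan1)
    ultimately have "r * c \<le> 0"
      by (intro tendsto_lowerbound[where F="at 0 within {0<..<y0}" and a="r * c"])
        (use fb in \<open>auto simp: eventually_at_filter\<close>)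
    then show False using r c by (simp add: mult_le_0_iff)
  qed

  \<comment> \<open>A total derivative, as the chain rule along characteristics demands.
    \<open>ws\<close> and \<open>wt\<close> equal the partial derivatives on the open interior, so
    they inherit it.\<close>
  have total: "((\<lambda>p. ws p + k * wt p) has_derivative (\<lambda>(x, y). (ds (ds w) q + k * ds (dt w) q) * x + (dt (ds w) q + k * dt (dt w) q) * y)) (at q)"
    if q: "q \<in> interior E" for q k
  proof -
    obtain s t where q': "q = (s, t)" by fastforce
    have "((\<lambda>p. ds w p + k * dt w p) has_derivative (\<lambda>(x, y). (ds (ds w) (s, t) + k * ds (dt w) (s, t)) * x + (dt (ds w) (s, t) + k * dt (dt w) (s, t)) * y)) (at (s, t))"
    proof (rule has_derivative_of_partials[OF open_interior])
      show "continuous_on (interior E) (\<lambda>q. dt (ds w) q + k * dt (dt w) q)"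
        by (intro continuous_intros c2 C)
    qed (use q q' in \<open>auto intro!: DERIV_add DERIV_cmult Ck_plane_DERIV[OF C(2)] Ck_plane_DERIV[OF C(3)]\<close>)
    then show ?thesis unfolding q'
      by (rule has_derivative_transform_within_open[OF _ open_interior q[unfolded q']]) (simp add: ws wt)
  qed
  have mixed: "dt (ds w) q = ds (dt w) q" if q: "q \<in> interior E" for q
  proof -
    obtain s t where q': "q = (s, t)" by fastforce
    show ?thesis unfolding q'
      by (rule mixed_partials_eq[OF open_interior q[unfolded q'], where F=w and Fs="ds w" and Ft="dt w"])
        (auto intro: Ck_plane_DERIV[OF C(1)] Ck_plane_DERIV[OF C(2)] Ck_plane_DERIV[OF C(3)] c2 C)
  qed
  have weq: "dt (dt w) q = ds (ds w) q" if "q \<in> interior E" for q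
    using eq[of q] trace_interior[OF ext(4) cl that] trace_interior[OF ext(7) cl that] that interior_subset by auto

  \<comment> \<open>\<open>k = 1\<close> and \<open>k = -1\<close> treat both families at once,
    along paths of velocity (-k, 1). There w_s + k w_t has derivative k (w_tt - w_ss) + (1 - k^2)
    w_st, which vanishes by the wave equation and k^2 = 1.\<close>
  have char: "ws (s, t) + k * wt (s, t) = ws (s + k * t, 0) + k * wt (s + k * t, 0)"
    if st: "(s, t) \<in> interior E" and k: "k = 1 \<or> k = -1" for s t k
  proof -
    define \<gamma> where "\<gamma> = (\<lambda>y. (s + k * (t - y), y))"
    have t: "0 < t" "t < T" "\<rho> t < s" using st by (auto simp: int)
    \<comment> \<open>Backwards in time the front retreats faster than 1 while the path moves left
      at speed 1 at most, so the path stays ahead.\<close>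
    have sub: "\<rho> y < s + k * (t - y)" if "0 \<le> y" "y \<le> t" for y
      using fast'[of y t] t that k by auto
    have "(\<lambda>y. ws (\<gamma> y) + k * wt (\<gamma> y)) t = (\<lambda>y. ws (\<gamma> y) + k * wt (\<gamma> y)) 0"
    proof (rule DERIV_isconst_end[OF t(1)])
      have "\<gamma> ` {0..t} \<subseteq> E" using sub t by (auto simp: \<gamma>_def E_def ext_region_def intro: less_imp_le)
      then show "continuous_on {0..t} (\<lambda>y. ws (\<gamma> y) + k * wt (\<gamma> y))"
        by (intro continuous_intros continuous_on_compose2[OF ws(1)] continuous_on_compose2[OF wt(1)])
          (auto simp: \<gamma>_def intro!: continuous_intros)
      fix y assume y: "0 < y" "y < t"
      have \<gamma>I: "\<gamma> y \<in> interior E" using sub[of y] y t by (auto simp: \<gamma>_def int)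
      have d\<gamma>: "(\<gamma> has_derivative (\<lambda>z. (- k * z, z))) (at y)"
        unfolding \<gamma>_def by (auto intro!: derivative_eq_intros simp: algebra_simps)
      have "((\<lambda>y. ws (\<gamma> y) + k * wt (\<gamma> y)) has_derivative
          (\<lambda>z. (ds (ds w) (\<gamma> y) + k * ds (dt w) (\<gamma> y)) * (- k * z) + (dt (ds w) (\<gamma> y) + k * dt (dt w) (\<gamma> y)) * z)) (at y)"
        using has_derivative_compose[OF d\<gamma> total[OF \<gamma>I, of k]] by simp
      also have "(\<lambda>z. (ds (ds w) (\<gamma> y) + k * ds (dt w) (\<gamma> y)) * (- k * z) + (dt (ds w) (\<gamma> y) + k * dt (dt w) (\<gamma> y)) * z) = (\<lambda>z. 0 * z)"
        using k mixed[OF \<gamma>I] weq[OF \<gamma>I] by (auto simp: algebra_simps)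
      finally show "((\<lambda>y. ws (\<gamma> y) + k * wt (\<gamma> y)) has_real_derivative 0) (at y)"
        by (simp add: has_field_derivative_def lambda_zero)
    qed
    then show ?thesis by (simp add: \<gamma>_def)
  qed

  have wt_eq: "dt w (s, t) = wave P1 (\<lambda>x. - Q1 x) (s, t)" if st: "(s, t) \<in> interior E" for s t
  proof -
    have t: "0 < t" "t < T" "\<rho> t < s" using st by (auto simp: int)
    \<comment> \<open>Both feet lie strictly ahead of the initial front, where \<open>ws0\<close> is
      available.\<close>
    have "\<rho> 0 < s - t" "\<rho> 0 < s + t" using fast'[of 0 t] t by auto
    then have "ws (s, t) + wt (s, t) = 2 * P1 (s + t)" "ws (s, t) - wt (s, t) = 2 * Q1 (s - t)"
      using char[OF st, of 1] char[OF st, of "-1"] ws0[of "s + t"] ws0[of "s - t"] w1[of "s + t"] w1[of "s - t"]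
      by (auto simp: wt_def)
    then show ?thesis using wt(2)[OF st] by (simp add: wave_apply)
  qed

  have c1: "continuous_on UNIV P" "continuous_on UNIV Q"
    using P Q by (auto intro: DERIV_isCont simp: continuous_on_eq_continuous_at)
  \<comment> \<open>\<open>w\<close> is recovered by integrating w_t along the vertical segment
    below (s, t): it stays in the region because the front only advances, and it ends at t = 0,
    where w is prescribed.\<close>
  have weqI: "w (s, t) = wave P Q (s, t)" if st: "(s, t) \<in> interior E" for s t
  proof -
    have t: "0 < t" "t < T" "\<rho> t < s" using st by (auto simp: int)
    have sub: "\<rho> y < s" if "0 \<le> y" "y \<le> t" for y
      using fast'[of y t] t that by auto
    have "(\<lambda>y. w (s, y) - wave P Q (s, y)) t = (\<lambda>y. w (s, y) - wave P Q (s, y)) 0"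
    proof (rule DERIV_isconst_end[OF t(1)])
      have "Pair s ` {0..t} \<subseteq> E" using sub t by (auto simp: E_def ext_region_def intro: less_imp_le)
      then show "continuous_on {0..t} (\<lambda>y. w (s, y) - wave P Q (s, y))"
        by (intro continuous_intros continuous_on_compose2[OF w] continuous_on_compose2[OF continuous_on_wave[OF c1, of UNIV]])
          (auto intro!: continuous_intros)
      fix y assume y: "0 < y" "y < t"
      have sy: "(s, y) \<in> interior E" using sub[of y] y t by (auto simp: int)
      then show "((\<lambda>y. w (s, y) - wave P Q (s, y)) has_real_derivative 0) (at y)"
        using DERIV_diff[OF Ck_plane_DERIV(2)[OF C(1) sy] DERIV_wave_t[OF P Q, of s y]] wt_eq[OF sy] by simp
    qed
    then show ?thesis using w0[of s] sub[of 0] t by (simp add: wave_apply)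
  qed
  have "trace E w p = wave P Q p"
    by (rule trace_eqI[OF cl continuous_on_wave[OF c1] p]) (use weqI in fast)
  moreover have "trace E w p = w p" by (rule trace_eqI[OF cl w p]) simp
  ultimately show ?thesis by simp
qed

section \<open>Construction of the front\<close>

lemma tendsto_nhds_continuous_on_UNIV:
  assumes "continuous_on UNIV f"
  shows "(f \<longlongrightarrow> f p) (nhds p)"
  using assms by (simp add: continuous_on_def tendsto_at_iff_tendsto_nhds)

lemma implicit_root:
  fixes H Hs Ht :: "real \<times> real \<Rightarrow> real"
  assumes Hs: "\<And>s t. ((\<lambda>x. H (x, t)) has_real_derivative Hs (s, t)) (at s)"
    and Ht: "\<And>s t. ((\<lambda>y. H (s, y)) has_real_derivative Ht (s, t)) (at t)"
    and cont: "continuous_on UNIV Hs" "continuous_on UNIV Ht"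
    and root: "\<And>t. t \<in> I \<Longrightarrow> lo \<le> \<sigma> t \<and> \<sigma> t \<le> hi \<and> H (\<sigma> t, t) = 0"
    and m: "0 < m" "\<And>s t. lo \<le> s \<Longrightarrow> s \<le> hi \<Longrightarrow> t \<in> I \<Longrightarrow> m \<le> Hs (s, t)"
  shows implicit_root_continuous: "continuous_on I \<sigma>"
    and implicit_root_DERIV: "t \<in> I \<Longrightarrow> (\<sigma> has_real_derivative - Ht (\<sigma> t, t) / Hs (\<sigma> t, t)) (at t within I)"
proof -
  have ex: "\<exists>\<xi>. \<bar>\<xi> - \<sigma> t\<bar> \<le> \<bar>\<sigma> y - \<sigma> t\<bar> \<and> m \<le> Hs (\<xi>, y) \<and> - H (\<sigma> t, y) = (\<sigma> y - \<sigma> t) * Hs (\<xi>, y)"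
    if ty: "t \<in> I" "y \<in> I" for t y
  proof -
    obtain \<xi> where \<xi>: "min (\<sigma> t) (\<sigma> y) \<le> \<xi>" "\<xi> \<le> max (\<sigma> t) (\<sigma> y)"
      "H (\<sigma> y, y) - H (\<sigma> t, y) = (\<sigma> y - \<sigma> t) * Hs (\<xi>, y)"
      using mvt_between[of "\<sigma> t" "\<sigma> y" "\<lambda>x. H (x, y)" "\<lambda>x. Hs (x, y)"] Hs by metis
    then show ?thesis using root[OF ty(1)] root[OF ty(2)] ty m(2)[of \<xi> y] by (intro exI[of _ \<xi>]) auto
  qed
  have lim: "(\<sigma> \<longlongrightarrow> \<sigma> t) (at t within I)" if t: "t \<in> I" for t
  proof -
    have "((\<lambda>y. H (\<sigma> t, y)) \<longlongrightarrow> H (\<sigma> t, t)) (at t within I)"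
      using DERIV_isCont[OF Ht] by (simp add: isCont_def tendsto_within_subset[of _ _ _ UNIV])
    then have "((\<lambda>y. \<bar>H (\<sigma> t, y)\<bar> / m) \<longlongrightarrow> \<bar>H (\<sigma> t, t)\<bar> / m) (at t within I)"
      using m by (intro tendsto_intros) auto
    then have "((\<lambda>y. \<bar>H (\<sigma> t, y)\<bar> / m) \<longlongrightarrow> 0) (at t within I)" using root[OF t] by simp
    then have "((\<lambda>y. \<sigma> y - \<sigma> t) \<longlongrightarrow> 0) (at t within I)"
    proof (rule Lim_null_comparison[rotated])
      have "norm (\<sigma> y - \<sigma> t) \<le> \<bar>H (\<sigma> t, y)\<bar> / m" if y: "y \<in> I" for y
      proof -
        obtain \<xi> where "m \<le> Hs (\<xi>, y)" "- H (\<sigma> t, y) = (\<sigma> y - \<sigma> t) * Hs (\<xi>, y)" using ex[OF t y] by auto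
        then have "\<bar>H (\<sigma> t, y)\<bar> = \<bar>\<sigma> y - \<sigma> t\<bar> * Hs (\<xi>, y)" using m(1)
          by (metis abs_minus abs_mult abs_of_nonneg less_eq_real_def order_less_le_trans)
        moreover have "\<bar>\<sigma> y - \<sigma> t\<bar> * m \<le> \<bar>\<sigma> y - \<sigma> t\<bar> * Hs (\<xi>, y)"
          using \<open>m \<le> Hs (\<xi>, y)\<close> by (rule mult_left_mono) simp
        ultimately show ?thesis using m(1) by (simp add: field_simps)
      qed
      then show "\<forall>\<^sub>F y in at t within I. norm (\<sigma> y - \<sigma> t) \<le> \<bar>H (\<sigma> t, y)\<bar> / m"
        by (simp add: eventually_at_filter)
    qed
    then show ?thesis using Lim_null by blast
  qed
  then show "continuous_on I \<sigma>" by (simp add: continuous_on_def)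

  assume t: "t \<in> I"
  have "\<forall>y. \<exists>\<theta>. \<bar>\<theta> - t\<bar> \<le> \<bar>y - t\<bar> \<and> H (\<sigma> t, y) - H (\<sigma> t, t) = (y - t) * Ht (\<sigma> t, \<theta>)"
  proof
    fix y
    obtain \<theta> where "min t y \<le> \<theta>" "\<theta> \<le> max t y" "H (\<sigma> t, y) - H (\<sigma> t, t) = (y - t) * Ht (\<sigma> t, \<theta>)"
      using mvt_between[of t y "\<lambda>y. H (\<sigma> t, y)" "\<lambda>y. Ht (\<sigma> t, y)"] Ht by metis
    then show "\<exists>\<theta>. \<bar>\<theta> - t\<bar> \<le> \<bar>y - t\<bar> \<and> H (\<sigma> t, y) - H (\<sigma> t, t) = (y - t) * Ht (\<sigma> t, \<theta>)"
      by (intro exI[of _ \<theta>]) auto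
  qed
  then obtain \<theta> where \<theta>: "\<And>y. \<bar>\<theta> y - t\<bar> \<le> \<bar>y - t\<bar>" "\<And>y. H (\<sigma> t, y) - H (\<sigma> t, t) = (y - t) * Ht (\<sigma> t, \<theta> y)"
    by metis
  obtain \<xi> where \<xi>: "\<And>y. y \<in> I \<Longrightarrow> \<bar>\<xi> y - \<sigma> t\<bar> \<le> \<bar>\<sigma> y - \<sigma> t\<bar>" "\<And>y. y \<in> I \<Longrightarrow> m \<le> Hs (\<xi> y, y)"
    "\<And>y. y \<in> I \<Longrightarrow> - H (\<sigma> t, y) = (\<sigma> y - \<sigma> t) * Hs (\<xi> y, y)"
    using ex[OF t] by metis
  have quot: "(\<sigma> y - \<sigma> t) / (y - t) = - Ht (\<sigma> t, \<theta> y) / Hs (\<xi> y, y)" if y: "y \<in> I" "y \<noteq> t" for y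
  proof -
    have "(\<sigma> y - \<sigma> t) * Hs (\<xi> y, y) = - ((y - t) * Ht (\<sigma> t, \<theta> y))" using \<xi>(3)[OF y(1)] \<theta>(2)[of y] root[OF t] by simp
    then show ?thesis using \<xi>(2)[OF y(1)] m(1) y(2) by (simp add: field_simps)
  qed
  have "((\<lambda>y. \<theta> y - t) \<longlongrightarrow> 0) (at t within I)"
    by (rule Lim_null_comparison[of _ "\<lambda>y. \<bar>y - t\<bar>"])
      (auto simp: \<theta>(1) intro!: tendsto_eq_intros always_eventually)
  then have \<theta>l: "(\<theta> \<longlongrightarrow> t) (at t within I)" using Lim_null by blast
  have "((\<lambda>y. \<xi> y - \<sigma> t) \<longlongrightarrow> 0) (at t within I)"
  proof (rule Lim_null_comparison[of _ "\<lambda>y. \<bar>\<sigma> y - \<sigma> t\<bar>"])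
    show "\<forall>\<^sub>F y in at t within I. norm (\<xi> y - \<sigma> t) \<le> \<bar>\<sigma> y - \<sigma> t\<bar>"
      using \<xi>(1) by (auto simp: eventually_at_filter)
    show "((\<lambda>y. \<bar>\<sigma> y - \<sigma> t\<bar>) \<longlongrightarrow> 0) (at t within I)"
      using lim[OF t] by (auto intro!: tendsto_eq_intros)
  qed
  then have \<xi>l: "(\<xi> \<longlongrightarrow> \<sigma> t) (at t within I)" using Lim_null by blast
  have "((\<lambda>y. Ht (\<sigma> t, \<theta> y)) \<longlongrightarrow> Ht (\<sigma> t, t)) (at t within I)"
    using cont(2) by (intro isCont_tendsto_compose[of _ Ht] tendsto_Pair \<theta>l tendsto_const)
      (simp add: continuous_on_eq_continuous_at)
  moreover have "((\<lambda>y. Hs (\<xi> y, y)) \<longlongrightarrow> Hs (\<sigma> t, t)) (at t within I)"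
    using cont(1) by (intro isCont_tendsto_compose[of _ Hs] tendsto_Pair \<xi>l tendsto_ident_at)
      (simp add: continuous_on_eq_continuous_at)
  ultimately have "((\<lambda>y. - Ht (\<sigma> t, \<theta> y) / Hs (\<xi> y, y)) \<longlongrightarrow> - Ht (\<sigma> t, t) / Hs (\<sigma> t, t)) (at t within I)"
    using m(1) m(2)[of "\<sigma> t" t] root[OF t] t by (intro tendsto_intros) auto
  then have "((\<lambda>y. (\<sigma> y - \<sigma> t) / (y - t)) \<longlongrightarrow> - Ht (\<sigma> t, t) / Hs (\<sigma> t, t)) (at t within I)"
    by (rule Lim_transform_eventually) (auto simp: eventually_at_filter quot)
  then show "(\<sigma> has_real_derivative - Ht (\<sigma> t, t) / Hs (\<sigma> t, t)) (at t within I)"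
    by (simp add: has_field_derivative_iff)
qed

text \<open>Near infinity the limit leaves a margin of half the gap L - l; on the remaining compact
  interval the minimum of f is attained.\<close>

lemma lower_margin_at_top:
  fixes f :: "real \<Rightarrow> real"
  assumes "continuous_on {c..} f" "(f \<longlongrightarrow> L) at_top" "l < L" "\<And>x. c \<le> x \<Longrightarrow> l < f x"
  obtains e where "e > 0" "\<And>x. c \<le> x \<Longrightarrow> l + e \<le> f x"
proof -
  have "\<forall>\<^sub>F x in at_top. (l + L) / 2 < f x" using assms(2,3) by (intro order_tendstoD) auto
  then obtain M where M: "\<And>x. M \<le> x \<Longrightarrow> (l + L) / 2 < f x" by (auto simp: eventually_at_top_linorder)
  have "continuous_on {c..max c M} f" using assms(1) by (rule continuous_on_subset) auto
  then obtain z where z: "z \<in> {c..max c M}" "\<And>y. y \<in> {c..max c M} \<Longrightarrow> f z \<le> f y"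
    using continuous_attains_inf[of "{c..max c M}" f] by auto
  show ?thesis
  proof (rule that[of "min ((L - l) / 2) (f z - l)"])
    show "0 < min ((L - l) / 2) (f z - l)" using assms(3,4) z(1) by auto
    fix x assume "c \<le> x"
    then show "l + min ((L - l) / 2) (f z - l) \<le> f x"
      using z(2)[of x] M[of x] by (cases "x \<le> M") (auto simp: min_def field_simps)
  qed
qed

text \<open>On s \<ge> \<sigma>0 the combinations P + Q, P1 + Q1, P1 - Q1 and P2 - Q2 stand for
  chi0, chi0', chi1 and chi1'. Since 2 P1 = chi0' + chi1, \<open>speed0\<close> is the condition
  that the initial speed chi1 / (N1 - chi0') exceeds 1.\<close>

locale front_problem =
  fixes N1 \<eta> \<tau> \<zeta> \<sigma>0 :: real and P P1 P2 Q Q1 Q2 :: "real \<Rightarrow> real"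
  assumes P: "\<And>x. (P has_real_derivative P1 x) (at x)" and P1: "\<And>x. (P1 has_real_derivative P2 x) (at x)"
    and Q: "\<And>x. (Q has_real_derivative Q1 x) (at x)" and Q1: "\<And>x. (Q1 has_real_derivative Q2 x) (at x)"
    and P2: "continuous_on UNIV P2" and Q2: "continuous_on UNIV Q2"
    and \<sigma>0: "0 < \<sigma>0" and \<tau>: "\<eta> < \<tau>" "\<tau> < N1"
    and bounds: "\<And>x. \<sigma>0 \<le> x \<Longrightarrow> \<eta> < P1 x + Q1 x \<and> P1 x + Q1 x < N1"
    and lim_s: "((\<lambda>x. P1 x + Q1 x) \<longlongrightarrow> \<tau>) at_top"
    and lim_t: "((\<lambda>x. P2 x - Q2 x) \<longlongrightarrow> \<zeta>) at_top"
    and front0: "P \<sigma>0 + Q \<sigma>0 = N1 * \<sigma>0"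
    and speed0: "N1 < 2 * P1 \<sigma>0"
begin

abbreviation "\<Phi> \<equiv> wave P Q"
abbreviation "\<Phi>s \<equiv> wave P1 Q1"
abbreviation "\<Phi>t \<equiv> wave P1 (\<lambda>x. - Q1 x)"

lemma cont: "continuous_on S P" "continuous_on S Q" "continuous_on S P1" "continuous_on S Q1"
  "continuous_on S P2" "continuous_on S Q2"
  using P Q P1 Q1 continuous_on_subset[OF P2] continuous_on_subset[OF Q2]
  by (auto intro!: DERIV_isCont simp: continuous_at_imp_continuous_on) (metis DERIV_isCont continuous_at_imp_continuous_on)+

lemma cont_wave: "continuous_on S \<Phi>" "continuous_on S \<Phi>s" "continuous_on S \<Phi>t"
  by (intro continuous_on_wave cont continuous_on_minus)+

text \<open>The mean of the initial slope at the two characteristic feet s \<plusminus> t, plus half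
  the increment of the initial velocity between them. The slope obeys the required bounds, and the
  increment is small for small t.\<close>

lemma \<Phi>s_split: "\<Phi>s (s, t) = ((P1 (s + t) + Q1 (s + t)) + (P1 (s - t) + Q1 (s - t))) / 2
    + ((P1 (s + t) - Q1 (s + t)) - (P1 (s - t) - Q1 (s - t))) / 2"
  by (simp add: wave_apply field_simps)

lemma D_difference: "((\<lambda>x. P1 x - Q1 x) has_real_derivative P2 x - Q2 x) (at x)"
  by (intro DERIV_diff P1 Q1)

text \<open>One time must serve an unbounded range of s. The initial slope keeps uniform margins
  \<open>e1\<close>, \<open>e2\<close> from both bounds, and chi1' is bounded because it converges
  at infinity, so the velocity increment in \<open>\<Phi>s_split\<close> is of order t uniformly in
  s.\<close>

lemma exterior_bounds:
  obtains T0 where "T0 > 0"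
    "\<And>s t. 0 \<le> t \<Longrightarrow> t \<le> T0 \<Longrightarrow> \<sigma>0 + t \<le> s \<Longrightarrow> \<eta> < \<Phi>s (s, t) \<and> \<Phi>s (s, t) < N1"
proof -
  obtain e1 where e1: "e1 > 0" "\<And>x. \<sigma>0 \<le> x \<Longrightarrow> \<eta> + e1 \<le> P1 x + Q1 x"
    by (rule lower_margin_at_top[OF _ lim_s \<tau>(1), of \<sigma>0]) (auto intro!: continuous_intros cont simp: bounds)
  obtain e2 where e2: "e2 > 0" "\<And>x. \<sigma>0 \<le> x \<Longrightarrow> - N1 + e2 \<le> - (P1 x + Q1 x)"
  proof (rule lower_margin_at_top[OF _ tendsto_minus[OF lim_s], of \<sigma>0 "-N1"])
    show "continuous_on {\<sigma>0..} (\<lambda>x. - (P1 x + Q1 x))" by (intro continuous_intros cont)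
    show "- N1 < - (P1 x + Q1 x)" if "\<sigma>0 \<le> x" for x using bounds[OF that] by simp
  qed (use \<tau> in auto)
  have "\<forall>\<^sub>F x in at_top. \<bar>P2 x - Q2 x\<bar> < \<bar>\<zeta>\<bar> + 1"
    using tendsto_rabs[OF lim_t] by (intro order_tendstoD(2)[where y="\<bar>\<zeta>\<bar>"]) auto
  then obtain M where M: "\<And>x. M \<le> x \<Longrightarrow> \<bar>P2 x - Q2 x\<bar> < \<bar>\<zeta>\<bar> + 1" by (auto simp: eventually_at_top_linorder)
  have "bounded ((\<lambda>x. P2 x - Q2 x) ` {\<sigma>0..M})"
    by (intro compact_imp_bounded compact_continuous_image continuous_intros cont) auto
  then obtain B0 where B0: "\<And>x. \<sigma>0 \<le> x \<Longrightarrow> x \<le> M \<Longrightarrow> \<bar>P2 x - Q2 x\<bar> \<le> B0"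
    unfolding bounded_iff by fastforce
  define B where "B = max B0 (\<bar>\<zeta>\<bar> + 1)"
  have B: "B > 0" "\<And>x. \<sigma>0 \<le> x \<Longrightarrow> \<bar>P2 x - Q2 x\<bar> \<le> B"
  proof -
    show "B > 0" by (auto simp: B_def max_def)
    fix x assume "\<sigma>0 \<le> x"
    then show "\<bar>P2 x - Q2 x\<bar> \<le> B"
      using B0[of x] M[of x] by (cases "x \<le> M") (auto simp: B_def intro: order_trans less_imp_le)
  qed
  \<comment> \<open>Half the velocity increment over an interval of length 2 t is at most t B, and
    \<open>T0\<close> B is half the smaller margin.\<close>
  define T0 where "T0 = min e1 e2 / (2 * B)"
  show ?thesis
  proof (rule that[of T0])
    show "T0 > 0" using e1 e2 B by (simp add: T0_def)
    fix s t assume t: "0 \<le> t" "t \<le> T0" and s: "\<sigma>0 + t \<le> s"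
    obtain z where z: "min (s - t) (s + t) \<le> z" "z \<le> max (s - t) (s + t)"
      "(P1 (s + t) - Q1 (s + t)) - (P1 (s - t) - Q1 (s - t)) = ((s + t) - (s - t)) * (P2 z - Q2 z)"
      by (rule mvt_between[OF D_difference])
    have "\<bar>((P1 (s + t) - Q1 (s + t)) - (P1 (s - t) - Q1 (s - t))) / 2\<bar> = t * \<bar>P2 z - Q2 z\<bar>"
      using z(3) t by (simp add: abs_mult)
    also have "\<dots> \<le> T0 * B" using t z(1) s B(2)[of z] by (intro mult_mono) auto
    also have "\<dots> = min e1 e2 / 2" using B by (simp add: T0_def)
    also have "\<dots> < min e1 e2" using e1(1) e2(1) by (simp add: min_def)
    finally have "\<bar>((P1 (s + t) - Q1 (s + t)) - (P1 (s - t) - Q1 (s - t))) / 2\<bar> < min e1 e2" .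
    then have d: "((P1 (s + t) - Q1 (s + t)) - (P1 (s - t) - Q1 (s - t))) / 2 < e2"
      "- e1 < ((P1 (s + t) - Q1 (s + t)) - (P1 (s - t) - Q1 (s - t))) / 2"
      by (auto simp: abs_less_iff)
    have st: "\<sigma>0 \<le> s + t" "\<sigma>0 \<le> s - t" using t s by auto
    have "\<eta> < \<Phi>s (s, t)" using d(2) e1(2)[OF st(1)] e1(2)[OF st(2)] unfolding \<Phi>s_split by argo
    moreover have "\<Phi>s (s, t) < N1" using d(1) e2(2)[OF st(1)] e2(2)[OF st(2)] unfolding \<Phi>s_split by argo
    ultimately show "\<eta> < \<Phi>s (s, t) \<and> \<Phi>s (s, t) < N1" by simp
  qed
qed

text \<open>By the mean value theorem half the velocity increment is t chi1'(z) for some z \<ge> s -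
  t. As s grows so does z, and this term tends to \<zeta> t.\<close>

lemma \<Phi>s_at_top:
  assumes "0 \<le> t"
  shows "((\<lambda>s. \<Phi>s (s, t)) \<longlongrightarrow> \<zeta> * t + \<tau>) at_top"
proof -
  have "\<exists>z. s - t \<le> z \<and> (P1 (s + t) - Q1 (s + t)) - (P1 (s - t) - Q1 (s - t)) = 2 * t * (P2 z - Q2 z)" for s
  proof -
    obtain z where z: "min (s - t) (s + t) \<le> z" "z \<le> max (s - t) (s + t)"
      "(P1 (s + t) - Q1 (s + t)) - (P1 (s - t) - Q1 (s - t)) = ((s + t) - (s - t)) * (P2 z - Q2 z)"
      by (rule mvt_between[OF D_difference])
    then show ?thesis using assms by (intro exI[of _ z]) auto
  qed
  then obtain z where z: "\<And>s. s - t \<le> z s"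
    "\<And>s. (P1 (s + t) - Q1 (s + t)) - (P1 (s - t) - Q1 (s - t)) = 2 * t * (P2 (z s) - Q2 (z s))"
    by metis
  have shift: "filterlim (\<lambda>s. s + c) at_top at_top" for c :: real
    using filterlim_tendsto_add_at_top[OF tendsto_const filterlim_ident, of c] by (simp add: add.commute)
  have zt: "filterlim z at_top at_top"
    by (rule filterlim_at_top_mono[OF shift[of "-t"]]) (use z(1) in \<open>auto intro!: always_eventually\<close>)
  have "((\<lambda>s. ((P1 (s + t) + Q1 (s + t)) + (P1 (s + - t) + Q1 (s + - t))) / 2
      + (2 * t * (P2 (z s) - Q2 (z s))) / 2) \<longlongrightarrow> (\<tau> + \<tau>) / 2 + (2 * t * \<zeta>) / 2) at_top"
    by (intro tendsto_intros filterlim_compose[OF lim_s] filterlim_compose[OF lim_t] shift zt) auto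
  then show ?thesis unfolding \<Phi>s_split z(2) by (simp add: algebra_simps)
qed

end

text \<open>\<open>exterior\<close> covers all s \<ge> \<sigma>0 + t rather than the points ahead of
  \<open>\<sigma>\<close>, since it must also apply to any other supersonic front from \<sigma>0.
  Continuity on the whole line makes the pieces of the solution Borel functions on the
  plane.\<close>

locale front_solution = front_problem +
  fixes T :: real and \<sigma> :: "real \<Rightarrow> real"
  assumes T: "T > 0" and \<sigma>_cont: "continuous_on UNIV \<sigma>" and \<sigma>_0: "\<sigma> 0 = \<sigma>0"
    and exterior: "\<And>s t. 0 \<le> t \<Longrightarrow> t \<le> T \<Longrightarrow> \<sigma>0 + t \<le> s \<Longrightarrow> \<eta> < \<Phi>s (s, t) \<and> \<Phi>s (s, t) < N1"
    and \<sigma>_ge: "\<And>t. 0 \<le> t \<Longrightarrow> t \<le> T \<Longrightarrow> \<sigma>0 + t \<le> \<sigma> t"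
    and \<sigma>_root: "\<And>t. 0 \<le> t \<Longrightarrow> t \<le> T \<Longrightarrow> \<Phi> (\<sigma> t, t) = N1 * \<sigma> t"
    and \<sigma>_speed: "\<And>t. 0 \<le> t \<Longrightarrow> t \<le> T \<Longrightarrow> 1 < \<Phi>t (\<sigma> t, t) / (N1 - \<Phi>s (\<sigma> t, t))"
    and \<sigma>_DERIV: "\<And>t. 0 < t \<Longrightarrow> t < T \<Longrightarrow> (\<sigma> has_real_derivative \<Phi>t (\<sigma> t, t) / (N1 - \<Phi>s (\<sigma> t, t))) (at t)"

text \<open>In a box around (\<sigma>0, 0) the function N1 s - \<open>\<Phi>\<close> increases in s
  and changes sign between the two sides, so the intermediate value theorem gives a root at each
  time; \<open>implicit_root\<close> then shows that the roots form a differentiable curve.\<close>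

lemma (in front_problem) exists_front:
  obtains T \<sigma> where "front_solution N1 \<eta> \<tau> \<zeta> \<sigma>0 P P1 P2 Q Q1 Q2 T \<sigma>"
proof -
  obtain T0 where T0: "T0 > 0"
    "\<And>s t. 0 \<le> t \<Longrightarrow> t \<le> T0 \<Longrightarrow> \<sigma>0 + t \<le> s \<Longrightarrow> \<eta> < \<Phi>s (s, t) \<and> \<Phi>s (s, t) < N1"
    using exterior_bounds by blast
  define H where "H = (\<lambda>p. N1 * fst p - \<Phi> p)"
  define Hs where "Hs = (\<lambda>p. N1 - \<Phi>s p)"
  define Ht where "Ht = (\<lambda>p. - \<Phi>t p)"
  have Hs: "((\<lambda>x. H (x, t)) has_real_derivative Hs (s, t)) (at s)" for s t
    unfolding H_def Hs_def fst_conv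
    by (intro DERIV_diff DERIV_wave_s P Q) (auto intro!: derivative_eq_intros)
  have Ht: "((\<lambda>y. H (s, y)) has_real_derivative Ht (s, t)) (at t)" for s t
    unfolding H_def Ht_def fst_conv
    using DERIV_diff[OF DERIV_const DERIV_wave_t[OF P Q], of "N1 * s" s t] by simp
  have HC: "continuous_on UNIV Hs" "continuous_on UNIV Ht"
    unfolding Hs_def Ht_def by (intro continuous_intros cont_wave)+
  \<comment> \<open>Half the value of \<open>Hs\<close> at the initial front, hence still a lower
    bound nearby.\<close>
  define m where "m = (N1 - \<Phi>s (\<sigma>0, 0)) / 2"
  have m: "m > 0" using bounds[of \<sigma>0] by (simp add: m_def wave_apply)
  have "\<forall>\<^sub>F p in nhds (\<sigma>0, 0). m < Hs p"
    by (rule order_tendstoD(1)[OF tendsto_nhds_continuous_on_UNIV[OF HC(1)]]) (use m in \<open>simp add: Hs_def m_def\<close>)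
  moreover have "\<forall>\<^sub>F p in nhds (\<sigma>0, 0). N1 < 2 * P1 (fst p + snd p)"
  proof (rule order_tendstoD(1)[OF tendsto_nhds_continuous_on_UNIV])
    show "continuous_on UNIV (\<lambda>p. 2 * P1 (fst p + snd p))"
      by (intro continuous_intros continuous_on_compose2[OF cont(3)[of UNIV]]) auto
  qed (simp add: speed0)
  ultimately obtain d where d: "d > 0"
    "\<And>p. dist p (\<sigma>0, 0) < d \<Longrightarrow> m < Hs p \<and> N1 < 2 * P1 (fst p + snd p)"
    by (metis (mono_tags, lifting) eventually_conj eventually_nhds_metric)
  \<comment> \<open>In the box |s - \<sigma>0| \<le> r, 0 \<le> t \<le> r the distance from
    (\<sigma>0, 0) is at most 2 r < d.\<close>
  define r where "r = d / 3"
  have r: "r > 0" using d by (simp add: r_def)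
  have box: "m < Hs (s, t) \<and> N1 < 2 * P1 (s + t)" if "\<sigma>0 - r \<le> s" "s \<le> \<sigma>0 + r" "0 \<le> t" "t \<le> r" for s t
  proof -
    have "dist (s, t) (\<sigma>0, 0) \<le> \<bar>s - \<sigma>0\<bar> + \<bar>t\<bar>"
      by (simp add: dist_Pair_Pair dist_real_def sqrt_sum_squares_le_sum_abs)
    also have "\<dots> < d" using that r by (auto simp: r_def)
    finally show ?thesis using d(2)[of "(s, t)"] by simp
  qed
  have H0: "H (\<sigma>0, 0) = 0" using front0 by (simp add: H_def wave_apply)
  have inc: "H (s, t) < H (s', t)" if "\<sigma>0 - r \<le> s" "s < s'" "s' \<le> \<sigma>0 + r" "0 \<le> t" "t \<le> r" for s s' t
  proof (rule DERIV_pos_imp_increasing[OF that(2)])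
    fix x assume "s \<le> x" "x \<le> s'"
    then show "\<exists>y. ((\<lambda>x. H (x, t)) has_real_derivative y) (at x) \<and> 0 < y"
      using Hs[of t x] box[of x t] that m by (intro exI[of _ "Hs (x, t)"]) auto
  qed
  have sgn: "H (\<sigma>0 - r, 0) < 0" "0 < H (\<sigma>0 + r, 0)"
    using inc[of "\<sigma>0 - r" \<sigma>0 0] inc[of \<sigma>0 "\<sigma>0 + r" 0] r H0 by auto
  have Hc: "((\<lambda>y. H (s, y)) \<longlongrightarrow> H (s, 0)) (nhds 0)" for s
    using DERIV_isCont[OF Ht, of 0 s] tendsto_at_iff_tendsto_nhds[of "\<lambda>y. H (s, y)" 0]
    by (simp add: isCont_def)
  have "\<forall>\<^sub>F y in nhds 0. H (\<sigma>0 - r, y) < 0 \<and> 0 < H (\<sigma>0 + r, y)"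
    using order_tendstoD(2)[OF Hc sgn(1)] order_tendstoD(1)[OF Hc sgn(2)] by (rule eventually_conj)
  then obtain d' where d': "d' > 0" "\<And>y. dist y 0 < d' \<Longrightarrow> H (\<sigma>0 - r, y) < 0 \<and> 0 < H (\<sigma>0 + r, y)"
    by (auto simp: eventually_nhds_metric)
  \<comment> \<open>\<open>T0\<close> serves the exterior bounds, \<open>r\<close> the box, and d' /
    2 keeps the sign change valid up to and including T.\<close>
  define T where "T = min T0 (min r (d' / 2))"
  have T: "T > 0" "T \<le> T0" "T \<le> r" "T < d'" using T0 r d' by (auto simp: T_def)
  have "\<forall>t\<in>{0..T}. \<exists>s. \<sigma>0 - r \<le> s \<and> s \<le> \<sigma>0 + r \<and> H (s, t) = 0"
  proof
    fix t assume t: "t \<in> {0..T}"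
    have "continuous_on {\<sigma>0 - r..\<sigma>0 + r} (\<lambda>s. H (s, t))"
      using DERIV_isCont[OF Hs] by (simp add: continuous_at_imp_continuous_on)
    then show "\<exists>s. \<sigma>0 - r \<le> s \<and> s \<le> \<sigma>0 + r \<and> H (s, t) = 0"
      using IVT'[of "\<lambda>s. H (s, t)" "\<sigma>0 - r" 0 "\<sigma>0 + r"] d'(2)[of t] t T r by auto
  qed
  then obtain \<sigma>1 where \<sigma>1: "\<And>t. t \<in> {0..T} \<Longrightarrow> \<sigma>0 - r \<le> \<sigma>1 t \<and> \<sigma>1 t \<le> \<sigma>0 + r \<and> H (\<sigma>1 t, t) = 0"
    by metis
  \<comment> \<open>Time is clamped to [0, T], so the front is constant outside and continuous on
    the whole line.\<close>
  define \<sigma> where "\<sigma> = (\<lambda>t. \<sigma>1 (max 0 (min T t)))"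
  have \<sigma>: "\<sigma>0 - r \<le> \<sigma> t \<and> \<sigma> t \<le> \<sigma>0 + r \<and> H (\<sigma> t, t) = 0" if "t \<in> {0..T}" for t
    using \<sigma>1[OF that] that by (simp add: \<sigma>_def)
  have mb: "m \<le> Hs (s, t)" if "\<sigma>0 - r \<le> s" "s \<le> \<sigma>0 + r" "t \<in> {0..T}" for s t
    using box[of s t] that T by auto
  have \<sigma>c: "continuous_on {0..T} \<sigma>"
    by (rule implicit_root_continuous[OF Hs Ht HC \<sigma> m mb])
  have "continuous_on UNIV (\<lambda>t. \<sigma> (max 0 (min T t)))"
    using T by (intro continuous_on_compose2[OF \<sigma>c] continuous_intros) auto
  then have \<sigma>C: "continuous_on UNIV \<sigma>" using T by (simp add: \<sigma>_def min.absorb1 min.absorb2 max.absorb2)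
  have speed: "1 < \<Phi>t (\<sigma> t, t) / (N1 - \<Phi>s (\<sigma> t, t))" if t: "0 \<le> t" "t \<le> T" for t
  proof -
    have "N1 - \<Phi>s (\<sigma> t, t) > 0" "N1 < 2 * P1 (\<sigma> t + t)"
      using box[of "\<sigma> t" t] \<sigma>[of t] t T m by (auto simp: Hs_def)
    then show ?thesis by (simp add: wave_apply)
  qed
  have D: "(\<sigma> has_real_derivative \<Phi>t (\<sigma> t, t) / (N1 - \<Phi>s (\<sigma> t, t))) (at t)" if t: "0 < t" "t < T" for t
    using implicit_root_DERIV[OF Hs Ht HC \<sigma> m mb, where t=t and I="{0..T}"] t
    by (simp add: Hs_def Ht_def at_within_Icc_at)
  have s0: "\<sigma> 0 = \<sigma>0"
    using inc[of "\<sigma> 0" \<sigma>0 0] inc[of \<sigma>0 "\<sigma> 0" 0] \<sigma>[of 0] H0 T r by (cases "\<sigma> 0" \<sigma>0 rule: linorder_cases) auto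
  have grow: "\<sigma>0 + t \<le> \<sigma> t" if t: "0 \<le> t" "t \<le> T" for t
  proof (cases "t = 0")
    case False
    have "(\<lambda>t. \<sigma> t - t) 0 < (\<lambda>t. \<sigma> t - t) t"
    proof (rule DERIV_pos_imp_increasing_open[where f="\<lambda>t. \<sigma> t - t"])
      show "0 < t" using t False by simp
      show "continuous_on {0..t} (\<lambda>t. \<sigma> t - t)"
        by (intro continuous_intros continuous_on_subset[OF \<sigma>C]) auto
      fix x assume "0 < x" "x < t"
      then show "\<exists>y. ((\<lambda>t. \<sigma> t - t) has_real_derivative y) (at x) \<and> 0 < y"
        using DERIV_diff[OF D DERIV_ident, of x] speed[of x] t
        by (intro exI[of _ "\<Phi>t (\<sigma> x, x) / (N1 - \<Phi>s (\<sigma> x, x)) - 1"]) auto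
    qed
    then show ?thesis using s0 by simp
  qed (simp add: s0)
  show ?thesis
  proof (rule that[of T \<sigma>], intro front_solution.intro front_solution_axioms.intro)
    show "\<eta> < \<Phi>s (s, t) \<and> \<Phi>s (s, t) < N1" if "0 \<le> t" "t \<le> T" "\<sigma>0 + t \<le> s" for s t
      using T0(2)[of t s] that T by simp
    show "\<Phi> (\<sigma> t, t) = N1 * \<sigma> t" if "0 \<le> t" "t \<le> T" for t
      using \<sigma>[of t] that by (simp add: H_def)
  qed (fact front_problem_axioms T(1) \<sigma>C s0 grow speed D)+
qed

section \<open>The solution with the constructed front\<close>

text \<open>Fubini reduces the claim to lines of constant s. On each, f \<phi> is continuous and
  differentiable off a finite set, so the fundamental theorem of calculus integrates its derivative
  f \<phi>_t + g \<phi>; no jump terms arise because f is continuous in t.\<close>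

lemma weak_dtI:
  fixes f g :: "real \<times> real \<Rightarrow> real"
  assumes fm: "f \<in> borel_measurable borel" and gm: "g \<in> borel_measurable borel"
    and fb: "\<And>K. compact K \<Longrightarrow> K \<subseteq> {0..} \<times> {0..T} \<Longrightarrow> \<exists>B. \<forall>p\<in>K. \<bar>f p\<bar> \<le> B"
    and gb: "\<And>K. compact K \<Longrightarrow> K \<subseteq> {0..} \<times> {0..T} \<Longrightarrow> \<exists>B. \<forall>p\<in>K. \<bar>g p\<bar> \<le> B"
    and cont: "\<And>s. 0 < s \<Longrightarrow> continuous_on {0..T} (\<lambda>t. f (s, t))"
    and fin: "\<And>s. 0 < s \<Longrightarrow> finite (X s)"
    and der: "\<And>s t. 0 < s \<Longrightarrow> 0 < t \<Longrightarrow> t < T \<Longrightarrow> t \<notin> X s \<Longrightarrow> ((\<lambda>y. f (s, y)) has_real_derivative g (s, t)) (at t)"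
    and T: "0 < T"
  shows "has_weak_dt_on f g ({0..} \<times> {0..T})"
  unfolding has_weak_dt_on_def
proof (intro allI impI)
  let ?D = "{0..} \<times> {0..T} :: (real \<times> real) set"
  fix \<phi> assume test: "test_function_on (interior ?D) \<phi>"
  have int: "interior ?D = {0<..} \<times> {0<..<T}" by (simp add: interior_Times)
  obtain K where K: "compact K" "K \<subseteq> {0<..} \<times> {0<..<T}" "\<And>p. p \<notin> K \<Longrightarrow> \<phi> p = 0"
    using test unfolding test_function_on_def int by blast
  have KD: "K \<subseteq> ?D" using K(2) by auto
  have C1: "Ck_plane (Suc 0) UNIV \<phi>" using test by (simp only: test_function_on_def)
  then have ext: "extends_cont UNIV \<phi>" "extends_cont UNIV (dt \<phi>)" by simp_all
  have cphi: "continuous_on UNIV \<phi>" "continuous_on UNIV (dt \<phi>)"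
    using ext by (auto simp: extends_cont_def elim: continuous_on_eq)
  have dphi: "((\<lambda>y. \<phi> (s, y)) has_real_derivative dt \<phi> (s, t)) (at t)" for s t
    using Ck_plane_DERIV(2)[OF C1, of s t] by simp
  have dt0: "dt \<phi> p = 0" if "p \<notin> K" for p
  proof -
    have "dt \<phi> p = dt (\<lambda>_. 0) p"
      using partials_cong(2)[of "- K" \<phi> "\<lambda>_. 0" p] K(1,3) that
      by (simp add: interior_open compact_imp_closed open_Compl)
    then show ?thesis by (simp add: dt_def split_beta)
  qed
  have pm: "\<phi> \<in> borel_measurable borel" "dt \<phi> \<in> borel_measurable borel"
    using cphi by (auto intro: borel_measurable_continuous_onI)
  define A where "A = (\<lambda>p. f p * dt \<phi> p)"
  define B where "B = (\<lambda>p. g p * \<phi> p)"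
  have ABm: "A \<in> borel_measurable borel" "B \<in> borel_measurable borel"
    unfolding A_def B_def using fm gm pm by measurable
  have AB0: "A p = 0" "B p = 0" if "p \<notin> K" for p
    using that K(3) dt0 by (auto simp: A_def B_def)
  have intg: "integrable lborel h" if h: "h \<in> borel_measurable borel" "\<And>p. p \<notin> K \<Longrightarrow> h p = 0" "\<exists>b. \<forall>p\<in>K. \<bar>h p\<bar> \<le> b" for h :: "real \<times> real \<Rightarrow> real"
  proof -
    obtain b where "\<forall>p\<in>K. \<bar>h p\<bar> \<le> b" using h(3) by blast
    then have "integrable lborel (\<lambda>p. indicator K p *\<^sub>R h p)"
      using K(1) h(1) emeasure_compact_finite[OF K(1)]
      by (intro integrableI_bounded_set_indicator[where B=b]) (auto simp: borel_compact)
    also have "(\<lambda>p. indicator K p *\<^sub>R h p) = h" using h(2) by (auto simp: indicator_def fun_eq_iff)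
    finally show ?thesis .
  qed
  have bd: "\<exists>b. \<forall>p\<in>K. \<bar>u p * v p\<bar> \<le> b" if uv: "\<exists>b. \<forall>p\<in>K. \<bar>u p\<bar> \<le> b" "continuous_on UNIV v" for u v :: "real \<times> real \<Rightarrow> real"
  proof -
    obtain b where b: "\<And>p. p \<in> K \<Longrightarrow> \<bar>u p\<bar> \<le> b" using uv(1) by blast
    have "bounded (v ` K)"
      using K(1) by (intro compact_imp_bounded compact_continuous_image continuous_on_subset[OF uv(2)]) auto
    then obtain c where c: "\<And>p. p \<in> K \<Longrightarrow> \<bar>v p\<bar> \<le> c" unfolding bounded_iff by fastforce
    have "\<bar>u p * v p\<bar> \<le> b * c" if "p \<in> K" for p
      using b[OF that] c[OF that] unfolding abs_mult by (intro mult_mono) auto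
    then show ?thesis by blast
  qed
  have Ai: "integrable lborel A" unfolding A_def
    by (rule intg) (use ABm AB0 bd[OF fb[OF K(1) KD] cphi(2)] in \<open>auto simp: A_def\<close>)
  have Bi: "integrable lborel B" unfolding B_def
    by (rule intg) (use ABm AB0 bd[OF gb[OF K(1) KD] cphi(1)] in \<open>auto simp: B_def\<close>)
  have inner: "(\<integral>t. A (s, t) + B (s, t) \<partial>lborel) = 0" for s
  \<comment> \<open>A slice that is not integrable has integral 0 by convention, so only integrable
    slices call for an argument.\<close>
  proof (cases "integrable lborel (\<lambda>t. A (s, t) + B (s, t))")
    case False
    then show ?thesis by (rule not_integrable_integral_eq)
  next
    case True
    have "((\<lambda>t. A (s, t) + B (s, t)) has_integral 0) {0..T}"
    proof (cases "0 < s")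
      case True
      have "((\<lambda>t. A (s, t) + B (s, t)) has_integral f (s, T) * \<phi> (s, T) - f (s, 0) * \<phi> (s, 0)) {0..T}"
      proof (rule fundamental_theorem_of_calculus_interior_strong[OF fin[OF True]])
        show "0 \<le> T" using T by simp
        show "continuous_on {0..T} (\<lambda>t. f (s, t) * \<phi> (s, t))"
          using cont[OF True] by (intro continuous_intros continuous_on_compose2[OF cphi(1)]) auto
        fix t assume "t \<in> {0<..<T} - X s"
        then have "((\<lambda>y. f (s, y)) has_real_derivative g (s, t)) (at t)" using der[OF True] by simp
        from DERIV_mult[OF this dphi[of s t]]
        show "((\<lambda>t. f (s, t) * \<phi> (s, t)) has_vector_derivative A (s, t) + B (s, t)) (at t)"
          by (simp add: A_def B_def has_real_derivative_iff_has_vector_derivative algebra_simps)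
      qed
      \<comment> \<open>The boundary terms vanish because the support of \<phi> lies in the open
        strip.\<close>
      moreover have "(s, T) \<notin> K" "(s, 0) \<notin> K" using K(2) by auto
      ultimately show ?thesis using K(3) by simp
    next
      case False
      then have "(s, t) \<notin> K" for t using K(2) by auto
      then show ?thesis using AB0 by simp
    qed
    then have "((\<lambda>t. A (s, t) + B (s, t)) has_integral 0) UNIV"
    proof (rule has_integral_on_superset)
      fix t assume "t \<notin> {0..T}"
      then have "(s, t) \<notin> K" using K(2) by auto
      then show "A (s, t) + B (s, t) = 0" using AB0 by simp
    qed simp
    with has_integral_integral_lborel[OF True] show ?thesis by (rule has_integral_unique)
  qed
  have "integral\<^sup>L lborel A + integral\<^sup>L lborel B = (\<integral>p. A p + B p \<partial>lborel)"
    using Ai Bi by simp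
  also have "\<dots> = (\<integral>s. (\<integral>t. A (s, t) + B (s, t) \<partial>lborel) \<partial>lborel)"
  proof -
    have "(\<lambda>(s, t). A (s, t) + B (s, t)) = (\<lambda>p. A p + B p)" by auto
    then show ?thesis
      using lborel_pair.integral_fst[of "\<lambda>s t. A (s, t) + B (s, t)"] Ai Bi by (simp only: lborel_prod Bochner_Integration.integrable_add)
  qed
  finally have sum0: "integral\<^sup>L lborel A + integral\<^sup>L lborel B = 0" using inner by simp
  have leb: "(LINT p:?D|lebesgue. h p) = integral\<^sup>L lborel h"
    if "h \<in> borel_measurable borel" "\<And>p. p \<notin> K \<Longrightarrow> h p = 0" for h :: "real \<times> real \<Rightarrow> real"
  proof -
    have "indicator ?D p *\<^sub>R h p = h p" for p
      using that(2)[of p] subsetD[OF KD, of p] by (cases "p \<in> K") auto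
    then have "(\<lambda>p. indicator ?D p *\<^sub>R h p) = h" by (rule HOL.ext)
    then show ?thesis using that(1) by (simp only: set_lebesgue_integral_def) (simp add: integral_completion)
  qed
  show "(LINT p:?D|lebesgue. f p * dt \<phi> p) = - (LINT p:?D|lebesgue. g p * \<phi> p)"
    using leb[OF ABm(1) AB0(1)] leb[OF ABm(2) AB0(2)] sum0 unfolding A_def B_def by linarith
qed

text \<open>\<rho> t - t is strictly increasing. Derivatives are used at interior times only, since
  at 0 and T the speed of a front is just a trace.\<close>

lemma front_supersonic:
  fixes \<rho> d :: "real \<Rightarrow> real"
  assumes "continuous_on {0..T} \<rho>"
    and "\<And>t. 0 < t \<Longrightarrow> t < T \<Longrightarrow> (\<rho> has_real_derivative d t) (at t)" "\<And>t. 0 < t \<Longrightarrow> t < T \<Longrightarrow> 1 < d t"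
    and "0 \<le> y" "y < t" "t \<le> T"
  shows "\<rho> y + (t - y) < \<rho> t"
proof -
  have "\<rho> y - y < \<rho> t - t"
  proof (rule DERIV_pos_imp_increasing_open[where f="\<lambda>t. \<rho> t - t", OF \<open>y < t\<close>])
    show "continuous_on {y..t} (\<lambda>t. \<rho> t - t)"
      using assms by (intro continuous_intros continuous_on_subset[OF assms(1)]) auto
    fix x assume x: "y < x" "x < t"
    then show "\<exists>z. ((\<lambda>t. \<rho> t - t) has_real_derivative z) (at x) \<and> 0 < z"
      using DERIV_diff[OF assms(2) DERIV_ident, of x] assms(3)[of x] assms(4-) by (intro exI[of _ "d x - 1"]) auto
  qed
  then show ?thesis by simp
qed

lemma Linf_onI:
  assumes "f \<in> borel_measurable borel" "\<And>p. p \<in> D \<Longrightarrow> \<bar>f p\<bar> \<le> B"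
  shows "Linf_on D f"
  unfolding Linf_on_def
proof
  show "f \<in> borel_measurable (lebesgue_on D)"
    using assms(1) by (intro measurable_restrict_space1 measurable_completion) simp
  show "\<exists>B. AE p in lebesgue_on D. \<bar>f p\<bar> \<le> B"
    using assms(2) by (intro exI[of _ B] AE_I2) (simp add: space_restrict_space)
qed

lemma continuous_on_bounded_compact:
  fixes f :: "'a::metric_space \<Rightarrow> real"
  assumes "continuous_on K f" "compact K"
  obtains B where "\<And>p. p \<in> K \<Longrightarrow> \<bar>f p\<bar> \<le> B"
proof -
  have "bounded (f ` K)" using assms by (intro compact_imp_bounded compact_continuous_image)
  then show ?thesis using that unfolding bounded_iff by fastforce
qed

section \<open>The explicit solution and its front conditions\<close>

context front_solution
begin

text \<open>\<open>n\<close> is the tension just ahead of the front, \<open>v\<close> the front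
  speed, and \<open>wake\<close> the tension behind it, as the momentum jump condition
  prescribes.\<close>

definition n :: "real \<Rightarrow> real" where "n t = \<Phi>s (\<sigma> t, t)"
definition v :: "real \<Rightarrow> real" where "v t = \<Phi>t (\<sigma> t, t) / (N1 - n t)"
definition wake :: "real \<Rightarrow> real" where "wake t = n t + (v t)\<^sup>2 * (N1 - n t)"
definition chi :: "real \<times> real \<Rightarrow> real" where
  "chi = (\<lambda>(s, t). if \<sigma> t \<le> s then \<Phi> (s, t) else N1 * s)"
definition chit :: "real \<times> real \<Rightarrow> real" where
  "chit = (\<lambda>(s, t). if \<sigma> t \<le> s then \<Phi>t (s, t) else 0)"
definition N :: "real \<times> real \<Rightarrow> real" where
  "N = (\<lambda>(s, t). if \<sigma> t \<le> s then \<Phi>s (s, t) else wake t)"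
definition E :: "(real \<times> real) set" where "E = ext_region T \<sigma>"

lemma \<sigma>_cont_on: "continuous_on S \<sigma>"
  using \<sigma>_cont by (rule continuous_on_subset) simp

lemma E_iff: "(s, t) \<in> E \<longleftrightarrow> 0 \<le> t \<and> t \<le> T \<and> \<sigma> t \<le> s"
  by (auto simp: E_def ext_region_def)

lemma interior_E: "(s, t) \<in> interior E \<longleftrightarrow> 0 < t \<and> t < T \<and> \<sigma> t < s"
  by (simp add: E_def interior_ext_region[OF \<sigma>_cont_on])

lemma E_closure: "E \<subseteq> closure (interior E)"
  unfolding E_def by (rule ext_region_subset_closure[OF \<sigma>_cont_on T])

lemma n_bounds: "0 \<le> t \<Longrightarrow> t \<le> T \<Longrightarrow> \<eta> < n t \<and> n t < N1"
  unfolding n_def by (intro exterior \<sigma>_ge)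

lemma n_cont: "continuous_on S n"
  unfolding n_def by (intro continuous_on_compose2[OF cont_wave(2)[of UNIV]] continuous_intros \<sigma>_cont_on) auto

lemma v_num_cont: "continuous_on S (\<lambda>t. \<Phi>t (\<sigma> t, t))"
  by (intro continuous_on_compose2[OF cont_wave(3)[of UNIV]] continuous_intros \<sigma>_cont_on) auto

lemma v_cont: "continuous_on {0..T} v"
  unfolding v_def using n_bounds by (intro continuous_intros v_num_cont n_cont) force

lemma v_gt_1: "0 \<le> t \<Longrightarrow> t \<le> T \<Longrightarrow> 1 < v t"
  unfolding v_def n_def by (rule \<sigma>_speed)

lemma \<sigma>_DERIV_v: "0 < t \<Longrightarrow> t < T \<Longrightarrow> (\<sigma> has_real_derivative v t) (at t)"
  unfolding v_def n_def by (rule \<sigma>_DERIV)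

text \<open>The excess \<open>wake t\<close> - N1 equals (v^2 - 1) (N1 - n), a product of two
  positive factors.\<close>

lemma wake_gt: "0 \<le> t \<Longrightarrow> t \<le> T \<Longrightarrow> N1 < wake t"
proof -
  assume t: "0 \<le> t" "t \<le> T"
  have "0 < ((v t)\<^sup>2 - 1) * (N1 - n t)"
    using v_gt_1[OF t] n_bounds[OF t] one_less_power[of "v t" 2] by (intro mult_pos_pos) auto
  then show ?thesis by (simp add: wake_def algebra_simps)
qed

lemma \<sigma>_fast: "0 \<le> y \<Longrightarrow> y < t \<Longrightarrow> t \<le> T \<Longrightarrow> \<sigma> y + (t - y) < \<sigma> t"
  by (rule front_supersonic[OF \<sigma>_cont_on \<sigma>_DERIV_v v_gt_1]) auto

text \<open>Bootstrapping: \<sigma>' = v is a quotient built from P1 (\<sigma> + t) and Q1 (\<sigma>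
  - t), so differentiability of \<sigma> passes to v. The resulting \<open>?v'\<close> involves P2,
  Q2 and v only continuously, and its denominator vanishes nowhere on [0, T].\<close>

lemma Ck_line_\<sigma>: "Ck_line 2 {0..T} \<sigma>"
proof -
  let ?p = "\<lambda>t. P1 (\<sigma> t + t)" and ?q = "\<lambda>t. Q1 (\<sigma> t - t)"
  let ?p' = "\<lambda>t. P2 (\<sigma> t + t) * (v t + 1)" and ?q' = "\<lambda>t. Q2 (\<sigma> t - t) * (v t - 1)"
  let ?v' = "\<lambda>t. ((?p' t - ?q' t) * (N1 - (?p t + ?q t)) - (?p t - ?q t) * (0 - (?p' t + ?q' t))) / ((N1 - (?p t + ?q t)) * (N1 - (?p t + ?q t)))"
  have veq: "v = (\<lambda>t. (?p t - ?q t) / (N1 - (?p t + ?q t)))"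
    by (simp add: v_def n_def wave_apply fun_eq_iff)
  have nz: "N1 - (?p t + ?q t) \<noteq> 0" if "0 \<le> t" "t \<le> T" for t
    using n_bounds[OF that] by (simp add: n_def wave_apply)
  have "Ck_line (Suc (Suc 0)) {0..T} \<sigma>"
  proof (rule Ck_line_SucI[where F=\<sigma> and F'=v])
    show "Ck_line (Suc 0) {0..T} v"
    proof (rule Ck_line_SucI[where F=v and F'="?v'"])
      show "Ck_line 0 {0..T} ?v'"
      proof (simp only: Ck_line.simps, rule extends_contI[where F="?v'"])
        show "continuous_on {0..T} ?v'"
          using nz by (intro continuous_intros v_cont \<sigma>_cont_on continuous_on_compose2[OF cont(3)[of UNIV]]
              continuous_on_compose2[OF cont(4)[of UNIV]] continuous_on_compose2[OF cont(5)[of UNIV]]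
              continuous_on_compose2[OF cont(6)[of UNIV]]) auto
      qed simp
      fix t assume "t \<in> interior {0..T}"
      then have t: "0 < t" "t < T" by auto
      have p: "(?p has_real_derivative ?p' t) (at t)"
        by (rule DERIV_chain2[OF P1]) (intro DERIV_add \<sigma>_DERIV_v t DERIV_ident)
      have q: "(?q has_real_derivative ?q' t) (at t)"
        by (rule DERIV_chain2[OF Q1]) (intro DERIV_diff \<sigma>_DERIV_v t DERIV_ident)
      show "(v has_real_derivative ?v' t) (at t)"
        unfolding veq
        using DERIV_divide[OF DERIV_diff[OF p q] DERIV_diff[OF DERIV_const DERIV_add[OF p q], of N1]] nz[of t] t
        by (simp add: veq)
    qed (use v_cont in auto)
  qed (use \<sigma>_DERIV_v \<sigma>_cont_on in auto)
  then show ?thesis by (simp only: numeral_2_eq_2)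
qed

text \<open>Serves both \<open>\<sigma>\<close> and the front of a competitor, which agrees with it
  on [0, T] but may differ outside; derivatives at interior times do not see the difference.\<close>

lemma trace_deriv_front:
  assumes "t \<in> {0..T}" "\<And>t. t \<in> {0..T} \<Longrightarrow> \<rho> t = \<sigma> t"
  shows "trace {0..T} (deriv \<rho>) t = v t"
proof (rule trace_eqI[OF Icc_subset_closure[OF T] v_cont assms(1)])
  fix t assume "t \<in> interior {0..T}"
  then have t: "t \<in> {0<..<T}" by simp
  have "(\<rho> has_real_derivative v t) (at t)"
    by (rule has_field_derivative_cong_open[OF open_greaterThanLessThan t, of \<sigma>])
      (use t assms(2) \<sigma>_DERIV_v in auto)
  then show "deriv \<rho> t = v t" by (rule DERIV_imp_deriv)
qed

lemma partials_\<Phi>: "ds \<Phi> = \<Phi>s" "dt \<Phi> = \<Phi>t" "ds \<Phi>s = wave P2 Q2" "dt \<Phi>s = wave P2 (\<lambda>x. - Q2 x)"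
  "ds \<Phi>t = wave P2 (\<lambda>x. - Q2 x)" "dt \<Phi>t = wave P2 Q2"
  using DERIV_imp_deriv[OF DERIV_wave_s[OF P Q]] DERIV_imp_deriv[OF DERIV_wave_t[OF P Q]]
    DERIV_imp_deriv[OF DERIV_wave_s[OF P1 Q1]] DERIV_imp_deriv[OF DERIV_wave_t[OF P1 Q1]]
    DERIV_imp_deriv[OF DERIV_wave_s[OF P1 DERIV_minus[OF Q1]]] DERIV_imp_deriv[OF DERIV_wave_t[OF P1 DERIV_minus[OF Q1]]]
  by (auto simp: ds_def dt_def fun_eq_iff)

lemma Ck_plane_wave0: "Ck_plane 0 R (wave P2 Q2)" "Ck_plane 0 R (wave P2 (\<lambda>x. - Q2 x))"
  by (simp_all, (rule extends_contI[where F="wave P2 Q2"] extends_contI[where F="wave P2 (\<lambda>x. - Q2 x)"],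
    intro continuous_on_wave cont continuous_on_minus, simp)+)

lemma Ck_plane_\<Phi>s: "Ck_plane 1 R \<Phi>s" and Ck_plane_\<Phi>t: "Ck_plane 1 R \<Phi>t"
proof -
  show "Ck_plane 1 R \<Phi>s" unfolding One_nat_def
    by (rule Ck_plane_SucI[OF cont_wave(2) _ DERIV_wave_s[OF P1 Q1] DERIV_wave_t[OF P1 Q1] Ck_plane_wave0]) simp
  show "Ck_plane 1 R \<Phi>t" unfolding One_nat_def
    using DERIV_wave_t[OF P1 DERIV_minus[OF Q1]]
    by (intro Ck_plane_SucI[OF cont_wave(3) _ DERIV_wave_s[OF P1 DERIV_minus[OF Q1]] _ Ck_plane_wave0(2,1)]) simp_all
qed

lemma Ck_plane_\<Phi>: "Ck_plane 2 R \<Phi>"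
  using Ck_plane_SucI[OF cont_wave(1) _ DERIV_wave_s[OF P Q] DERIV_wave_t[OF P Q] Ck_plane_\<Phi>s Ck_plane_\<Phi>t, of R \<Phi>]
  by (simp only: numeral_2_eq_2 One_nat_def)

text \<open>Stated for an arbitrary \<open>w\<close> so as to apply to \<open>chi\<close> in its own
  region and to a competitor in the region of the competing front.\<close>

lemma trace_eq_wave:
  assumes R: "R \<subseteq> closure (interior R)" and eq: "\<And>p. p \<in> interior R \<Longrightarrow> w p = \<Phi> p" and p: "p \<in> R"
  shows "trace R (ds w) p = \<Phi>s p" "trace R (dt w) p = \<Phi>t p"
    "trace R (dt (dt w)) p = trace R (ds (ds w)) p"
proof -
  note c = partials_cong[of R w \<Phi>, OF eq, unfolded partials_\<Phi>]
  show "trace R (ds w) p = \<Phi>s p" by (rule trace_eqI[OF R cont_wave(2) p c(1)])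
  show "trace R (dt w) p = \<Phi>t p" by (rule trace_eqI[OF R cont_wave(3) p c(2)])
  have "ds (ds w) q = dt (dt w) q" if "q \<in> interior R" for q
    using partials_cong(1)[of R "ds w" \<Phi>s, OF c(1) that] partials_cong(2)[of R "dt w" \<Phi>t, OF c(2) that]
    by (simp add: partials_\<Phi>)
  then have "trace R (ds (ds w)) = trace R (dt (dt w))" by (rule trace_cong)
  then show "trace R (dt (dt w)) p = trace R (ds (ds w)) p" by simp
qed

lemma wave_right_limits:
  "((\<lambda>s. \<Phi> (s, t)) \<longlongrightarrow> \<Phi> (a, t)) (at_right a)" "((\<lambda>s. \<Phi>s (s, t)) \<longlongrightarrow> \<Phi>s (a, t)) (at_right a)"
  "((\<lambda>s. \<Phi>t (s, t)) \<longlongrightarrow> \<Phi>t (a, t)) (at_right a)"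
proof -
  have lim: "((\<lambda>s. f (s, t)) \<longlongrightarrow> f (a, t)) (at_right a)" if "isCont (\<lambda>s. f (s, t)) a" for f :: "real \<times> real \<Rightarrow> real"
    using that tendsto_within_subset[of _ _ a UNIV "{a<..}"] by (simp add: isCont_def)
  show "((\<lambda>s. \<Phi> (s, t)) \<longlongrightarrow> \<Phi> (a, t)) (at_right a)" by (rule lim[OF DERIV_isCont[OF DERIV_wave_s[OF P Q]]])
  show "((\<lambda>s. \<Phi>s (s, t)) \<longlongrightarrow> \<Phi>s (a, t)) (at_right a)" by (rule lim[OF DERIV_isCont[OF DERIV_wave_s[OF P1 Q1]]])
  show "((\<lambda>s. \<Phi>t (s, t)) \<longlongrightarrow> \<Phi>t (a, t)) (at_right a)"
    by (rule lim[OF DERIV_isCont[OF DERIV_wave_s[OF P1 DERIV_minus[OF Q1]]]])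
qed

lemma is_shock_front_\<sigma>:
  assumes init: "initial_front N1 \<eta> \<tau> \<zeta> chi0 chi1 N0 = \<sigma>0"
    and c0: "\<And>s. \<sigma>0 \<le> s \<Longrightarrow> chi0 s = P s + Q s"
    and c1: "\<And>s. \<sigma>0 \<le> s \<Longrightarrow> trace {\<sigma>0..} chi1 s = P1 s - Q1 s"
  shows "is_shock_front N1 \<eta> \<tau> \<zeta> chi0 chi1 N0 T chi N \<sigma>"
proof -
  have chi: "chi p = \<Phi> p" if "p \<in> interior E" for p
    using that interior_E[of "fst p" "snd p"] by (auto simp: chi_def split: prod.splits)
  have N: "N p = \<Phi>s p" if "p \<in> interior E" for p
    using that interior_E[of "fst p" "snd p"] by (auto simp: N_def split: prod.splits)
  have tr: "trace E (ds chi) p = \<Phi>s p" "trace E (dt chi) p = \<Phi>t p"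
    "trace E (dt (dt chi)) p = trace E (ds (ds chi)) p" if "p \<in> E" for p
    using trace_eq_wave[OF E_closure _ that, of chi] chi by blast+
  have trN: "trace E N p = \<Phi>s p" if "p \<in> E" for p
    by (rule trace_eqI[OF E_closure cont_wave(2) that N])
  have Nr: "rlim (\<lambda>s. N (s, t)) (\<sigma> t) = n t" for t
    unfolding n_def by (rule rlim_eqI[OF wave_right_limits(2)]) (simp add: N_def)
  have d: "trace {0..T} (deriv \<sigma>) t = v t" if "t \<in> {0..T}" for t
    using trace_deriv_front[OF that] by simp
  have rchi: "rlim (\<lambda>s. chi (s, t)) (\<sigma> t) = N1 * \<sigma> t" if "t \<in> {0..T}" for t
    using rlim_eqI[OF wave_right_limits(1), of "\<sigma> t" "\<lambda>s. chi (s, t)" t] \<sigma>_root[of t] that by (simp add: chi_def)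
  have rchit: "rlim (\<lambda>s. trace E (dt chi) (s, t)) (\<sigma> t) = \<Phi>t (\<sigma> t, t)" if "t \<in> {0..T}" for t
    by (rule rlim_eqI[OF wave_right_limits(3)]) (use that tr(2) in \<open>auto simp: E_iff\<close>)
  show ?thesis
    unfolding is_shock_front_def Let_def init E_def[symmetric]
  proof (intro conjI ballI allI impI; (clarsimp simp only: case_prod_conv)?)
    show "continuous_on {0..T} \<sigma>" by (rule \<sigma>_cont_on)
    show "Ck_line 2 {0..T} \<sigma>" by (rule Ck_line_\<sigma>)
    show "\<sigma> 0 = \<sigma>0" by (rule \<sigma>_0)
    show "\<sigma>0 \<le> \<sigma> t" if "t \<in> {0..T}" for t using that \<sigma>_ge[of t] by auto
    show "Ck_plane 2 E chi" using Ck_plane_\<Phi> Ck_plane_cong[of E chi \<Phi>, OF chi] by simp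
    show "Ck_plane 1 E N" using Ck_plane_\<Phi>s Ck_plane_cong[of E N \<Phi>s, OF N] by simp
    show "trace E N p = trace E (ds chi) p" if "p \<in> E" for p using trN[OF that] tr(1)[OF that] by simp
    have ext: "\<eta> < \<Phi>s p \<and> \<Phi>s p < N1" if "p \<in> E" for p
    proof -
      obtain s t where p: "p = (s, t)" by fastforce
      show ?thesis using that exterior[of t s] \<sigma>_ge[of t] unfolding p E_iff by auto
    qed
    show "\<eta> < trace E N p" "trace E N p < N1" if "p \<in> E" for p using ext[OF that] trN[OF that] by auto
    show "N (s, t) = trace E (ds chi) (s, t)" if "(s, t) \<in> E" "\<sigma> t < s" for s t
      using tr(1)[OF that(1)] that by (simp add: N_def)
    show "rlim (\<lambda>s. chi (s, t)) (\<sigma> t) = N1 * \<sigma> t" if "t \<in> {0..T}" for t by (rule rchi[OF that])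
    show "trace {0..T} (deriv \<sigma>) t = rlim (\<lambda>s. trace E (dt chi) (s, t)) (\<sigma> t) / (N1 - rlim (\<lambda>s. N (s, t)) (\<sigma> t))"
      if "t \<in> {0..T}" for t using d[OF that] rchit[OF that] Nr[of t] by (simp add: v_def)
    show "1 < trace {0..T} (deriv \<sigma>) t" if "t \<in> {0..T}" for t using d[OF that] v_gt_1[of t] that by simp
    \<comment> \<open>At s = \<sigma> t itself \<open>chi\<close> takes the exterior formula, and
      \<open>\<sigma>_root\<close> makes the two values equal.\<close>
    show "chi (s, t) = N1 * s" if "t \<in> {0..T}" "s \<in> {0..\<sigma> t}" for s t
      using that \<sigma>_root[of t] by (auto simp: chi_def)
    show "N (s, t) = rlim (\<lambda>s. N (s, t)) (\<sigma> t) + (trace {0..T} (deriv \<sigma>) t)\<^sup>2 * (N1 - rlim (\<lambda>s. N (s, t)) (\<sigma> t))"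
      if "t \<in> {0..T}" "s \<in> {0..<\<sigma> t}" for s t
      unfolding Nr d[OF that(1)] using that by (simp add: N_def wake_def)
    show "N1 < N (s, t)" if "t \<in> {0..T}" "s \<in> {0..<\<sigma> t}" for s t
      using that wake_gt[of t] by (simp add: N_def)
    show "trace E (dt (dt chi)) p = trace E (ds (ds chi)) p" if "p \<in> E" for p by (rule tr(3)[OF that])
    show "((\<lambda>s. trace E (ds chi) (s, t)) \<longlongrightarrow> \<zeta> * t + \<tau>) at_top" if t: "t \<in> {0..T}" for t
    proof (rule Lim_transform_eventually[OF \<Phi>s_at_top])
      show "0 \<le> t" using t by simp
      show "\<forall>\<^sub>F s in at_top. \<Phi>s (s, t) = trace E (ds chi) (s, t)"
        using eventually_ge_at_top[of "\<sigma> t"] by eventually_elim (use t tr(1) in \<open>auto simp: E_iff\<close>)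
    qed
    show "chi (s, 0) = chi0 s" "trace E (dt chi) (s, 0) = trace {\<sigma>0..} chi1 s" if "\<sigma>0 \<le> s" for s
      using that c0[OF that] c1[OF that] tr(2)[of "(s, 0)"] T
      by (auto simp: chi_def \<sigma>_0 wave_apply E_iff)
  qed
qed


section \<open>Measurability, boundedness and the weak time derivative\<close>

lemma measurable_pieces: "{p. \<sigma> (snd p) \<le> fst p} \<in> sets borel"
proof -
  have "continuous_on UNIV (\<lambda>p :: real \<times> real. \<sigma> (snd p))"
    by (intro continuous_on_compose2[OF \<sigma>_cont] continuous_intros) auto
  then show ?thesis by (intro borel_closed closed_Collect_le continuous_intros)
qed

lemma pieces_alt:
  "chi = (\<lambda>p. if \<sigma> (snd p) \<le> fst p then \<Phi> p else N1 * fst p)"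
  "chit = (\<lambda>p. if \<sigma> (snd p) \<le> fst p then \<Phi>t p else 0)"
  "N = (\<lambda>p. if \<sigma> (snd p) \<le> fst p then \<Phi>s p else wake (snd p))"
  by (auto simp: chi_def chit_def N_def fun_eq_iff)

lemma chi_measurable: "chi \<in> borel_measurable borel"
  and chit_measurable: "chit \<in> borel_measurable borel"
  and N_measurable: "N \<in> borel_measurable borel"
proof -
  have m: "(\<lambda>p. if \<sigma> (snd p) \<le> fst p then f p else g p) \<in> borel_measurable borel"
    if "f \<in> borel_measurable borel" "g \<in> borel_measurable borel" for f g :: "real \<times> real \<Rightarrow> real"
    using that measurable_pieces by (intro measurable_If) (auto simp: space_borel)
  have w: "\<Phi> \<in> borel_measurable borel" "\<Phi>s \<in> borel_measurable borel" "\<Phi>t \<in> borel_measurable borel"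
    by (intro borel_measurable_continuous_onI cont_wave)+
  have "n \<in> borel_measurable borel" "v \<in> borel_measurable borel"
    unfolding v_def
    by (intro borel_measurable_divide borel_measurable_diff borel_measurable_const
        borel_measurable_continuous_onI v_num_cont n_cont)+
  then have "wake \<in> borel_measurable borel" unfolding wake_def by measurable
  then have wk: "(\<lambda>p. wake (snd p)) \<in> borel_measurable borel"
    by (rule measurable_compose[rotated]) (intro borel_measurable_continuous_onI continuous_intros)
  have fst: "(\<lambda>p :: real \<times> real. N1 * fst p) \<in> borel_measurable borel"
    by (intro borel_measurable_continuous_onI continuous_intros)
  show "chi \<in> borel_measurable borel" unfolding pieces_alt by (rule m[OF w(1) fst])
  show "chit \<in> borel_measurable borel" unfolding pieces_alt by (rule m[OF w(3)]) simp
  show "N \<in> borel_measurable borel" unfolding pieces_alt by (rule m[OF w(2) wk])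
qed

lemma chi_cont: "continuous_on ({0..} \<times> {0..T}) chi"
proof -
  have "continuous_on ({0..} \<times> {0..T}) (\<lambda>p. if \<sigma> (snd p) - fst p \<le> 0 then \<Phi> p else N1 * fst p)"
  proof (rule continuous_on_cases_le)
    show "continuous_on {p \<in> {0..} \<times> {0..T}. \<sigma> (snd p) - fst p \<le> 0} \<Phi>" by (rule cont_wave)
    show "continuous_on ({0..} \<times> {0..T}) (\<lambda>p. \<sigma> (snd p) - fst p)"
      by (intro continuous_intros continuous_on_compose2[OF \<sigma>_cont]) auto
    fix p :: "real \<times> real" assume p: "p \<in> {0..} \<times> {0..T}" "\<sigma> (snd p) - fst p = 0"
    then show "\<Phi> p = N1 * fst p" using \<sigma>_root[of "snd p"] by (cases p) auto
  qed (intro continuous_intros)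
  then show ?thesis by (simp add: pieces_alt)
qed

text \<open>A front with positive speed crosses each line of constant s at most once, so the
  exceptional sets are finite; off the crossing \<open>chi\<close> is locally either a wave or
  constant in time.\<close>

lemma chi_weak_dt: "has_weak_dt_on chi chit ({0..} \<times> {0..T})"
proof (rule weak_dtI[OF chi_measurable chit_measurable _ _ _ _ _ T, where X="\<lambda>s. {t. 0 < t \<and> t < T \<and> \<sigma> t = s}"])
  show "\<exists>B. \<forall>p\<in>K. \<bar>chi p\<bar> \<le> B" if K: "compact K" "K \<subseteq> {0..} \<times> {0..T}" for K
    by (rule continuous_on_bounded_compact[OF continuous_on_subset[OF chi_cont K(2)] K(1)]) blast
  show "\<exists>B. \<forall>p\<in>K. \<bar>chit p\<bar> \<le> B" if K: "compact K" for K
  proof -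
    obtain B where "\<And>p. p \<in> K \<Longrightarrow> \<bar>\<Phi>t p\<bar> \<le> B"
      using continuous_on_bounded_compact[OF cont_wave(3) K] by blast
    then have "\<forall>p\<in>K. \<bar>chit p\<bar> \<le> max B 0" by (force simp: chit_def)
    then show ?thesis by blast
  qed
  fix s :: real assume s: "0 < s"
  show "continuous_on {0..T} (\<lambda>t. chi (s, t))"
    using s by (intro continuous_on_compose2[OF chi_cont] continuous_intros) auto
  have inj: "t = t'" if "0 < t" "t < T" "0 < t'" "t' < T" "\<sigma> t = \<sigma> t'" for t t'
    using that \<sigma>_fast[of t t'] \<sigma>_fast[of t' t] by (cases t t' rule: linorder_cases) auto
  show "finite {t. 0 < t \<and> t < T \<and> \<sigma> t = s}"
  proof (cases "\<exists>t. 0 < t \<and> t < T \<and> \<sigma> t = s")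
    case True
    then obtain t where "0 < t" "t < T" "\<sigma> t = s" by blast
    then have "{t. 0 < t \<and> t < T \<and> \<sigma> t = s} \<subseteq> {t}" using inj by auto
    then show ?thesis using finite_subset by blast
  next
    case False
    then have "{t. 0 < t \<and> t < T \<and> \<sigma> t = s} = {}" by auto
    then show ?thesis by (simp only: finite.emptyI)
  qed
  fix t assume t: "0 < t" "t < T" "t \<notin> {t. 0 < t \<and> t < T \<and> \<sigma> t = s}"
  then consider "\<sigma> t < s" | "s < \<sigma> t" by fastforce
  then show "((\<lambda>y. chi (s, y)) has_real_derivative chit (s, t)) (at t)"
  proof cases
    case 1
    have "open {y. \<sigma> y < s}" using \<sigma>_cont by (intro open_Collect_less) auto
    then show ?thesis
      by (rule has_field_derivative_cong_open[OF _ _ _ DERIV_wave_t[OF P Q], THEN back_subst[of "\<lambda>D. (_ has_real_derivative D) _"]])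
        (use 1 in \<open>auto simp: chi_def chit_def\<close>)
  next
    case 2
    have "open {y. s < \<sigma> y}" using \<sigma>_cont by (intro open_Collect_less) auto
    then show ?thesis
      by (rule has_field_derivative_cong_open[OF _ _ _ DERIV_const, THEN back_subst[of "\<lambda>D. (_ has_real_derivative D) _"]])
        (use 2 in \<open>auto simp: chi_def chit_def\<close>)
  qed
qed

lemma Linf_N: "Linf_on ({0..} \<times> {0..T}) N"
proof -
  have "continuous_on {0..T} wake" unfolding wake_def by (intro continuous_intros n_cont v_cont)
  then obtain B where B: "\<And>t. t \<in> {0..T} \<Longrightarrow> \<bar>wake t\<bar> \<le> B"
    using continuous_on_bounded_compact[of "{0..T}" wake] by blast
  show ?thesis
  proof (rule Linf_onI[OF N_measurable])
    fix p :: "real \<times> real" assume "p \<in> {0..} \<times> {0..T}"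
    then obtain s t where p: "p = (s, t)" "0 \<le> t" "t \<le> T" by auto
    show "\<bar>N p\<bar> \<le> max B (max \<bar>\<eta>\<bar> \<bar>N1\<bar>)"
      using p B[of t] exterior[of t s] \<sigma>_ge[of t] by (auto simp: N_def)
  qed
qed

lemma Linf_chit: "Linf_loc_on ({0..} \<times> {0..T}) chit"
  unfolding Linf_loc_on_def
proof (intro allI impI)
  fix K :: "(real \<times> real) set" assume "compact K \<and> K \<subseteq> {0..} \<times> {0..T}"
  then obtain B where "\<And>p. p \<in> K \<Longrightarrow> \<bar>\<Phi>t p\<bar> \<le> B"
    using continuous_on_bounded_compact[OF cont_wave(3), of K] by blast
  then show "Linf_on K chit"
    by (intro Linf_onI[OF chit_measurable, of _ "max B 0"]) (force simp: chit_def)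
qed

text \<open>The competing front is supersonic by its own speed condition, so
  \<open>wave_unique\<close> identifies \<open>chi'\<close> with \<open>\<Phi>\<close> ahead of it.
  Its position is then a root of the same equation as \<sigma> t. With the fronts equal, the tension
  follows: ahead from chi_s, behind from the jump formula.\<close>

lemma front_unique:
  assumes init: "initial_front N1 \<eta> \<tau> \<zeta> chi0 chi1 N0 = \<sigma>0"
    and c0: "\<And>s. \<sigma>0 \<le> s \<Longrightarrow> chi0 s = P s + Q s"
    and c1: "\<And>s. \<sigma>0 \<le> s \<Longrightarrow> trace {\<sigma>0..} chi1 s = P1 s - Q1 s"
    and front: "is_shock_front N1 \<eta> \<tau> \<zeta> chi0 chi1 N0 T chi' N' \<rho>"
    and chi': "continuous_on ({0..} \<times> {0..T}) chi'"
  shows "t \<in> {0..T} \<Longrightarrow> \<rho> t = \<sigma> t"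
    and "0 \<le> s \<Longrightarrow> t \<in> {0..T} \<Longrightarrow> chi' (s, t) = chi (s, t)"
    and "0 \<le> s \<Longrightarrow> t \<in> {0..T} \<Longrightarrow> s \<noteq> \<sigma> t \<Longrightarrow> N' (s, t) = N (s, t)"
proof -
  define R where "R = ext_region T \<rho>"
  note F = front[unfolded is_shock_front_def Let_def init, folded R_def]
  have \<rho>: "continuous_on {0..T} \<rho>" and \<rho>2: "Ck_line 2 {0..T} \<rho>" and \<rho>_ge: "\<And>t. t \<in> {0..T} \<Longrightarrow> \<sigma>0 \<le> \<rho> t" and \<rho>0: "\<rho> 0 = \<sigma>0"
    and C2: "Ck_plane 2 R chi'"
    and ext: "\<And>s t. (s, t) \<in> R \<Longrightarrow> \<rho> t < s \<Longrightarrow> N' (s, t) = trace R (ds chi') (s, t)"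
    and fast: "\<And>t. t \<in> {0..T} \<Longrightarrow> 1 < trace {0..T} (deriv \<rho>) t"
    and flat: "\<And>t s. t \<in> {0..T} \<Longrightarrow> s \<in> {0..\<rho> t} \<Longrightarrow> chi' (s, t) = N1 * s"
    and wak: "\<And>t s. t \<in> {0..T} \<Longrightarrow> s \<in> {0..<\<rho> t} \<Longrightarrow> N' (s, t) = rlim (\<lambda>s. N' (s, t)) (\<rho> t) + (trace {0..T} (deriv \<rho>) t)\<^sup>2 * (N1 - rlim (\<lambda>s. N' (s, t)) (\<rho> t))"
    and weq: "\<And>p. p \<in> R \<Longrightarrow> trace R (dt (dt chi')) p = trace R (ds (ds chi')) p"
    and ic: "\<And>s. \<sigma>0 \<le> s \<Longrightarrow> chi' (s, 0) = chi0 s" "\<And>s. \<sigma>0 \<le> s \<Longrightarrow> trace R (dt chi') (s, 0) = trace {\<sigma>0..} chi1 s"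
    using F by (fastforce, fastforce, fastforce, fastforce, fastforce, fast, blast, blast, blast, blast, blast, blast)
  have \<rho>C: "Ck_line (Suc (Suc 0)) {0..T} \<rho>" using \<rho>2 by (simp only: numeral_2_eq_2)
  have d\<rho>: "(\<rho> has_real_derivative trace {0..T} (deriv \<rho>) t) (at t)" if "0 < t" "t < T" for t
  proof -
    have "extends_cont {0..T} (deriv \<rho>)" using \<rho>C by simp
    then show ?thesis
      using Ck_line_DERIV[OF \<rho>C, of t] trace_interior[of "{0..T}" "deriv \<rho>" t] Icc_subset_closure[OF T] that by simp
  qed
  have \<rho>_fast: "\<rho> y + (t - y) < \<rho> t" if "0 \<le> y" "y < t" "t \<le> T" for y t
    by (rule front_supersonic[OF \<rho> d\<rho> fast _ _ _]) (use that in auto)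
  have R_iff: "(s, t) \<in> R \<longleftrightarrow> 0 \<le> t \<and> t \<le> T \<and> \<rho> t \<le> s" for s t by (auto simp: R_def ext_region_def)
  have R_sub: "R \<subseteq> {0..} \<times> {0..T}"
  proof
    fix p assume "p \<in> R"
    then show "p \<in> {0..} \<times> {0..T}" using \<rho>_ge[of "snd p"] \<sigma>0 R_iff[of "fst p" "snd p"] by (cases p) auto
  qed
  have eqR: "chi' p = \<Phi> p" if "p \<in> R" for p
    unfolding R_def
  proof (rule wave_unique[OF T \<rho> \<rho>_fast C2[unfolded R_def] _ weq[unfolded R_def] _ _ P Q cont(3) cont(4)])
    show "continuous_on (ext_region T \<rho>) chi'" using chi' R_sub unfolding R_def by (rule continuous_on_subset)
    show "chi' (s, 0) = P s + Q s" if "\<rho> 0 \<le> s" for s using ic(1)[of s] c0[of s] that \<rho>0 by simp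
    show "trace (ext_region T \<rho>) (dt chi') (s, 0) = P1 s - Q1 s" if "\<rho> 0 \<le> s" for s
      using ic(2)[of s] c1[of s] that \<rho>0 by (simp add: R_def)
    show "p \<in> ext_region T \<rho>" using that by (simp add: R_def)
  qed
  have \<rho>\<sigma>: "\<rho> t = \<sigma> t" if t: "t \<in> {0..T}" for t
  proof -
    \<comment> \<open>This places \<rho> t in the half-line on which \<open>exterior\<close> makes
      N1 x - \<open>\<Phi>\<close> strictly increasing.\<close>
    have ge: "\<sigma>0 + t \<le> \<rho> t" using \<rho>_fast[of 0 t] t \<rho>0 by (cases "t = 0") auto
    have root: "N1 * \<rho> t - \<Phi> (\<rho> t, t) = 0"
      using flat[OF t, of "\<rho> t"] \<rho>_ge[OF t] \<sigma>0 eqR[of "(\<rho> t, t)"] t by (simp add: R_iff)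
    have inc: "N1 * x - \<Phi> (x, t) < N1 * y - \<Phi> (y, t)" if "\<sigma>0 + t \<le> x" "x < y" for x y
    proof (rule DERIV_pos_imp_increasing[OF that(2)])
      fix z assume "x \<le> z" "z \<le> y"
      then have "\<Phi>s (z, t) < N1" using exterior[of t z] t that by simp
      moreover have "((\<lambda>x. N1 * x - \<Phi> (x, t)) has_real_derivative N1 - \<Phi>s (z, t)) (at z)"
        by (intro DERIV_diff DERIV_wave_s P Q) (auto intro!: derivative_eq_intros)
      ultimately show "\<exists>D. ((\<lambda>x. N1 * x - \<Phi> (x, t)) has_real_derivative D) (at z) \<and> 0 < D"
        by (intro exI[of _ "N1 - \<Phi>s (z, t)"]) simp
    qed
    show ?thesis
      using inc[OF ge, of "\<sigma> t"] inc[of "\<sigma> t" "\<rho> t"] \<sigma>_ge[of t] root \<sigma>_root[of t] t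
      by (cases "\<rho> t" "\<sigma> t" rule: linorder_cases) auto
  qed
  show "t \<in> {0..T} \<Longrightarrow> \<rho> t = \<sigma> t" by (rule \<rho>\<sigma>)
  show "chi' (s, t) = chi (s, t)" if "0 \<le> s" "t \<in> {0..T}"
    using eqR[of "(s, t)"] flat[of t s] \<rho>\<sigma>[of t] that by (auto simp: chi_def R_iff)
  have N'_ext: "N' (s, t) = \<Phi>s (s, t)" if "t \<in> {0..T}" "\<sigma> t < s" for s t
  proof -
    have st: "(s, t) \<in> R" "\<rho> t < s" using that \<rho>\<sigma>[of t] by (auto simp: R_iff)
    have "trace R (ds chi') (s, t) = \<Phi>s (s, t)"
      by (rule trace_eq_wave(1)[OF _ _ st(1)])
        (use ext_region_subset_closure[OF \<rho> T] eqR interior_subset[of R] in \<open>auto simp: R_def\<close>)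
    then show ?thesis using ext[OF st] by simp
  qed
  show "N' (s, t) = N (s, t)" if st: "0 \<le> s" "t \<in> {0..T}" "s \<noteq> \<sigma> t"
  proof (cases "\<sigma> t < s")
    case True
    then show ?thesis using N'_ext[OF st(2)] by (simp add: N_def)
  next
    case False
    then have s: "s < \<sigma> t" using st(3) by simp
    \<comment> \<open>The limit looks only to the right of the front, where N' is already known, and
      thereby fixes the value behind it.\<close>
    have "rlim (\<lambda>s. N' (s, t)) (\<sigma> t) = n t"
      unfolding n_def by (rule rlim_eqI[OF wave_right_limits(2)]) (rule N'_ext[OF st(2)])
    moreover have "trace {0..T} (deriv \<rho>) t = v t" by (rule trace_deriv_front[OF st(2) \<rho>\<sigma>])
    ultimately show ?thesis using wak[OF st(2), of s] s st by (simp add: \<rho>\<sigma> N_def wake_def)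
  qed
qed

lemma classical_solution:
  assumes init: "initial_front N1 \<eta> \<tau> \<zeta> chi0 chi1 N0 = \<sigma>0"
    and c0: "\<And>s. \<sigma>0 \<le> s \<Longrightarrow> chi0 s = P s + Q s"
    and c1: "\<And>s. \<sigma>0 \<le> s \<Longrightarrow> trace {\<sigma>0..} chi1 s = P1 s - Q1 s"
  shows "classical_shock_solution N1 \<eta> \<tau> \<zeta> chi0 chi1 N0 T chi N"
    and "is_shock_front N1 \<eta> \<tau> \<zeta> chi0 chi1 N0 T chi N \<sigma>"
    and "classical_shock_solution N1 \<eta> \<tau> \<zeta> chi0 chi1 N0 T chi' N' \<Longrightarrow> same_shock_solution T \<sigma> chi N chi' N'"
proof -
  note u = front_unique[OF init c0 c1]
  show f: "is_shock_front N1 \<eta> \<tau> \<zeta> chi0 chi1 N0 T chi N \<sigma>"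
    by (rule is_shock_front_\<sigma>[OF init c0 c1])
  show "classical_shock_solution N1 \<eta> \<tau> \<zeta> chi0 chi1 N0 T chi N"
    unfolding classical_shock_solution_def
  proof (intro conjI exI allI impI ballI)
    show "\<rho> t = \<sigma> t" if "is_shock_front N1 \<eta> \<tau> \<zeta> chi0 chi1 N0 T chi N \<rho>" "t \<in> {0..T}" for \<rho> t
      using u(1)[OF _ _ that(1) chi_cont that(2)] by blast
  qed (fact chi_cont Linf_N Linf_chit chi_weak_dt f)+
  show "same_shock_solution T \<sigma> chi N chi' N'" if "classical_shock_solution N1 \<eta> \<tau> \<zeta> chi0 chi1 N0 T chi' N'"
  proof -
    from that obtain \<rho> where c: "continuous_on ({0..} \<times> {0..T}) chi'"
      and \<rho>: "is_shock_front N1 \<eta> \<tau> \<zeta> chi0 chi1 N0 T chi' N' \<rho>"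
      unfolding classical_shock_solution_def by blast
    show ?thesis unfolding same_shock_solution_def
      using u(2)[OF _ _ \<rho> c] u(3)[OF _ _ \<rho> c] by blast
  qed
qed

end

section \<open>From initial data to d'Alembert profiles\<close>

lemma antiderivative_UNIV:
  fixes f :: "real \<Rightarrow> real"
  assumes "continuous_on UNIV f"
  obtains F where "\<And>x. (F has_real_derivative f x) (at x)" "F c = y"
proof -
  have "isCont f x" for x using assms by (simp add: continuous_on_eq_continuous_at)
  then obtain F where F: "\<And>x. (F has_vector_derivative f x) (at x)"
    using einterval_antiderivative[of "-\<infinity>" "\<infinity>" f] by auto
  show ?thesis
  proof (rule that[of "\<lambda>x. F x - F c + y"])
    show "((\<lambda>x. F x - F c + y) has_real_derivative f x) (at x)" for x
      using F[of x] by (auto intro!: derivative_eq_intros simp: has_real_derivative_iff_has_vector_derivative[symmetric])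
  qed simp
qed

lemma eq_antiderivative_atLeast:
  fixes F G :: "real \<Rightarrow> real"
  assumes "continuous_on {c..} F" "\<And>x. c < x \<Longrightarrow> (F has_real_derivative f x) (at x)"
    and "\<And>x. (G has_real_derivative g x) (at x)" "\<And>x. c < x \<Longrightarrow> g x = f x" "G c = F c" "c \<le> x"
  shows "F x = G x"
proof (cases "x = c")
  case False
  have "F x - G x = F c - G c"
  proof (rule DERIV_isconst_end[where f="\<lambda>x. F x - G x"])
    show "c < x" using False assms(6) by simp
    show "continuous_on {c..x} (\<lambda>x. F x - G x)"
      using assms(1) DERIV_isCont[OF assms(3)]
      by (intro continuous_intros continuous_on_subset[OF assms(1)]) (auto simp: continuous_at_imp_continuous_on)
    show "((\<lambda>x. F x - G x) has_real_derivative 0) (at z)" if "c < z" for z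
      using DERIV_diff[OF assms(2)[OF that] assms(3)[of z]] assms(4)[OF that] by simp
  qed
  then show ?thesis using assms(5) by simp
qed (simp add: assms(5))

text \<open>Between two candidates a < b the function chi0 would have slope N1, as a point behind b,
  and slope less than N1, as a point ahead of a. The tensions may differ: chi0 alone
  decides.\<close>

lemma initial_front_unique:
  assumes "is_initial_front N1 \<eta> \<tau> \<zeta> chi0 chi1 N0 \<sigma>0" "is_initial_front N1 \<eta> \<tau> \<zeta> chi0 chi1 N0' \<sigma>0'"
  shows "\<sigma>0 = \<sigma>0'"
proof -
  have "\<not> a < b" if a: "is_initial_front N1 \<eta> \<tau> \<zeta> chi0 chi1 M a" and b: "is_initial_front N1 \<eta> \<tau> \<zeta> chi0 chi1 M' b" for a b M M'
  proof
    assume ab: "a < b"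
    define s where "s = (a + b) / 2"
    have s: "a < s" "s < b" using ab by (auto simp: s_def)
    have a0: "0 < a" and C: "Ck_line 2 {a..} chi0"
      and lt: "trace {a..} (deriv chi0) s < N1" and eq: "\<And>x. x \<in> {0..b} \<Longrightarrow> chi0 x = N1 * x"
      using a b s unfolding is_initial_front_def by (auto simp: less_imp_le) (metis less_imp_le)+
    have "(chi0 has_real_derivative N1) (at s)"
      by (rule has_field_derivative_cong_open[of "{0<..<b}" s "\<lambda>x. N1 * x"])
        (use s a0 eq in \<open>auto intro!: derivative_eq_intros\<close>)
    then have "deriv chi0 s = N1" by (rule DERIV_imp_deriv)
    moreover have "extends_cont {a..} (deriv chi0)" using C by (simp add: numeral_2_eq_2)
    then have "trace {a..} (deriv chi0) s = deriv chi0 s"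
      using s atLeast_subset_closure by (intro trace_interior) auto
    ultimately show False using lt by simp
  qed
  from this[OF assms] this[OF assms(2,1)] show ?thesis by simp
qed

text \<open>The data are extended to the left of \<sigma>0 by freezing the highest derivatives,
  chi0'' and chi1', at their boundary traces and integrating back with the right values at
  \<sigma>0. Working from the highest derivative down yields the regularity of the lower ones for
  free.\<close>

lemma data_front_problem:
  assumes data: "is_initial_front N1 \<eta> \<tau> \<zeta> chi0 chi1 N0 \<sigma>0" and c: "continuous_on {0..} chi0"
    and \<tau>: "\<eta> < \<tau>" "\<tau> < N1"
  obtains P P1 P2 Q Q1 Q2 where "front_problem N1 \<eta> \<tau> \<zeta> \<sigma>0 P P1 P2 Q Q1 Q2"
    "\<And>s. \<sigma>0 \<le> s \<Longrightarrow> chi0 s = P s + Q s" "\<And>s. \<sigma>0 \<le> s \<Longrightarrow> trace {\<sigma>0..} chi1 s = P1 s - Q1 s"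
proof -
  let ?R = "{\<sigma>0..}"
  note D = data[unfolded is_initial_front_def]
  have \<sigma>0: "0 < \<sigma>0" and C: "Ck_line 2 ?R chi0" "Ck_line 1 ?R chi1"
    and bd: "\<And>s. \<sigma>0 \<le> s \<Longrightarrow> \<eta> < trace ?R (deriv chi0) s \<and> trace ?R (deriv chi0) s < N1"
    and lim: "(deriv chi0 \<longlongrightarrow> \<tau>) at_top" "(deriv chi1 \<longlongrightarrow> \<zeta>) at_top"
    and front0: "chi0 \<sigma>0 = N1 * \<sigma>0" and speed: "front_speed0 N1 chi0 chi1 \<sigma>0 > 1"
    using D by (blast, blast, blast, metis, blast, blast, blast, blast)
  have C': "Ck_line (Suc (Suc 0)) ?R chi0" "Ck_line (Suc 0) ?R (deriv chi0)" "Ck_line (Suc 0) ?R chi1"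
    using C by (simp_all add: numeral_2_eq_2)
  have ext: "extends_cont ?R (deriv chi0)" "extends_cont ?R (deriv (deriv chi0))"
    "extends_cont ?R chi1" "extends_cont ?R (deriv chi1)"
    using C' by simp_all
  note cl = atLeast_subset_closure[of \<sigma>0]
  note cont = continuous_on_trace[OF ext(1) cl] continuous_on_trace[OF ext(2) cl]
    continuous_on_trace[OF ext(3) cl] continuous_on_trace[OF ext(4) cl]
  have tr: "trace ?R (deriv chi0) x = deriv chi0 x" "trace ?R (deriv (deriv chi0)) x = deriv (deriv chi0) x"
    "trace ?R chi1 x = chi1 x" "trace ?R (deriv chi1) x = deriv chi1 x" if "\<sigma>0 < x" for x
    using that ext cl by (simp_all add: trace_interior)
  have maxc: "continuous_on UNIV (\<lambda>x. f (max \<sigma>0 x))" if "continuous_on ?R f" for f :: "real \<Rightarrow> real"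
    by (intro continuous_on_compose2[OF that] continuous_intros) auto
  \<comment> \<open>Composition with \<open>max \<sigma>0\<close> is the constant continuation to
    the left.\<close>
  define a2 where "a2 = (\<lambda>x. trace ?R (deriv (deriv chi0)) (max \<sigma>0 x))"
  define b1 where "b1 = (\<lambda>x. trace ?R (deriv chi1) (max \<sigma>0 x))"
  have a2c: "continuous_on UNIV a2" and b1c: "continuous_on UNIV b1"
    unfolding a2_def b1_def by (intro maxc cont)+
  obtain a1 where a1: "\<And>x. (a1 has_real_derivative a2 x) (at x)" "a1 \<sigma>0 = trace ?R (deriv chi0) \<sigma>0"
    using antiderivative_UNIV[OF a2c] by blast
  have cts: "continuous_on UNIV f" if "\<And>x. (f has_real_derivative f' x) (at x)" for f f' :: "real \<Rightarrow> real"
    using DERIV_isCont[OF that] by (simp add: continuous_at_imp_continuous_on)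
  obtain a where a: "\<And>x. (a has_real_derivative a1 x) (at x)" "a \<sigma>0 = chi0 \<sigma>0"
    using antiderivative_UNIV[OF cts[OF a1(1)]] by blast
  obtain b where b: "\<And>x. (b has_real_derivative b1 x) (at x)" "b \<sigma>0 = trace ?R chi1 \<sigma>0"
    using antiderivative_UNIV[OF b1c] by blast
  \<comment> \<open>The primitive of the velocity enters \<open>\<Phi>\<close> only through B (s +
    t) - B (s - t), so its additive constant is free.\<close>
  obtain B where B: "\<And>x. (B has_real_derivative b x) (at x)"
    using antiderivative_UNIV[OF cts[OF b(1)]] by blast
  have a1_eq: "trace ?R (deriv chi0) x = a1 x" if "\<sigma>0 \<le> x" for x
  proof (rule eq_antiderivative_atLeast[OF cont(1) _ a1(1) _ a1(2) that])
    show "(trace ?R (deriv chi0) has_real_derivative deriv (deriv chi0) x) (at x)" if "\<sigma>0 < x" for x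
      by (rule has_field_derivative_cong_open[of "{\<sigma>0<..}" x "deriv chi0"])
        (use that tr Ck_line_DERIV[OF C'(2), of x] in auto)
  qed (simp add: a2_def tr)
  have b_eq: "trace ?R chi1 x = b x" if "\<sigma>0 \<le> x" for x
  proof (rule eq_antiderivative_atLeast[OF cont(3) _ b(1) _ b(2) that])
    show "(trace ?R chi1 has_real_derivative deriv chi1 x) (at x)" if "\<sigma>0 < x" for x
      by (rule has_field_derivative_cong_open[of "{\<sigma>0<..}" x chi1])
        (use that tr Ck_line_DERIV[OF C'(3), of x] in auto)
  qed (simp add: b1_def tr)
  have a_eq: "chi0 x = a x" if "\<sigma>0 \<le> x" for x
  proof (rule eq_antiderivative_atLeast[where F=chi0 and G=a and g=a1 and f="deriv chi0", OF _ _ a(1) _ a(2) that])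
    show "continuous_on ?R chi0" using \<sigma>0 by (intro continuous_on_subset[OF c]) auto
    show "(chi0 has_real_derivative deriv chi0 x) (at x)" if "\<sigma>0 < x" for x
      using that Ck_line_DERIV[OF C'(1), of x] by simp
    show "a1 x = deriv chi0 x" if "\<sigma>0 < x" for x using a1_eq[of x] tr(1)[OF that] that by simp
  qed
  have "rlim chi1 \<sigma>0 = b \<sigma>0" "rlim (deriv chi0) \<sigma>0 = a1 \<sigma>0"
  proof -
    show "rlim chi1 \<sigma>0 = b \<sigma>0"
    proof (rule rlim_eqI)
      show "(b \<longlongrightarrow> b \<sigma>0) (at_right \<sigma>0)"
        using DERIV_isCont[OF b(1), of \<sigma>0] by (auto simp: isCont_def intro: tendsto_within_subset)
      show "chi1 x = b x" if "\<sigma>0 < x" for x using b_eq[of x] tr(3)[OF that] that by simp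
    qed
    show "rlim (deriv chi0) \<sigma>0 = a1 \<sigma>0"
    proof (rule rlim_eqI)
      show "(a1 \<longlongrightarrow> a1 \<sigma>0) (at_right \<sigma>0)"
        using DERIV_isCont[OF a1(1), of \<sigma>0] by (auto simp: isCont_def intro: tendsto_within_subset)
      show "deriv chi0 x = a1 x" if "\<sigma>0 < x" for x using a1_eq[of x] tr(1)[OF that] that by simp
    qed
  qed
  \<comment> \<open>Clearing the positive denominator gives N1 < a1 + b at \<sigma>0, and a1 + b is
    twice the derivative of the left-moving profile.\<close>
  then have "1 < b \<sigma>0 / (N1 - a1 \<sigma>0)" using speed by (simp add: front_speed0_def)
  moreover have "a1 \<sigma>0 < N1" using bd[of \<sigma>0] a1_eq[of \<sigma>0] by simp
  ultimately have speed': "N1 < a1 \<sigma>0 + b \<sigma>0" by (simp add: field_simps)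
  show ?thesis
  proof (rule that)
    show "front_problem N1 \<eta> \<tau> \<zeta> \<sigma>0 (\<lambda>x. (a x + B x) / 2) (\<lambda>x. (a1 x + b x) / 2) (\<lambda>x. (a2 x + b1 x) / 2)
       (\<lambda>x. (a x - B x) / 2) (\<lambda>x. (a1 x - b x) / 2) (\<lambda>x. (a2 x - b1 x) / 2)"
    proof
      fix x
      show "((\<lambda>x. (a x + B x) / 2) has_real_derivative (a1 x + b x) / 2) (at x)"
        by (intro DERIV_cdivide DERIV_add a B)
      show "((\<lambda>x. (a x - B x) / 2) has_real_derivative (a1 x - b x) / 2) (at x)"
        by (intro DERIV_cdivide DERIV_diff a B)
      show "((\<lambda>x. (a1 x + b x) / 2) has_real_derivative (a2 x + b1 x) / 2) (at x)"
        by (intro DERIV_cdivide DERIV_add a1 b)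
      show "((\<lambda>x. (a1 x - b x) / 2) has_real_derivative (a2 x - b1 x) / 2) (at x)"
        by (intro DERIV_cdivide DERIV_diff a1 b)
      show "continuous_on UNIV (\<lambda>x. (a2 x + b1 x) / 2)" "continuous_on UNIV (\<lambda>x. (a2 x - b1 x) / 2)"
        by (intro continuous_intros a2c b1c; simp)+
      show "\<eta> < (a1 x + b x) / 2 + (a1 x - b x) / 2 \<and> (a1 x + b x) / 2 + (a1 x - b x) / 2 < N1" if "\<sigma>0 \<le> x"
        using bd[OF that] a1_eq[OF that] by (simp add: field_simps)
      have "(a1 \<longlongrightarrow> \<tau>) at_top"
      proof (rule Lim_transform_eventually[OF lim(1)])
        show "\<forall>\<^sub>F x in at_top. deriv chi0 x = a1 x"
          using eventually_gt_at_top[of \<sigma>0] by eventually_elim (use a1_eq tr(1) in \<open>auto simp: less_imp_le\<close>)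
      qed
      then show "((\<lambda>x. (a1 x + b x) / 2 + (a1 x - b x) / 2) \<longlongrightarrow> \<tau>) at_top"
        by (simp flip: add_divide_distrib)
      have "(b1 \<longlongrightarrow> \<zeta>) at_top"
      proof (rule Lim_transform_eventually[OF lim(2)])
        show "\<forall>\<^sub>F x in at_top. deriv chi1 x = b1 x"
          using eventually_gt_at_top[of \<sigma>0] by eventually_elim (use tr(4) in \<open>auto simp: b1_def\<close>)
      qed
      then show "((\<lambda>x. (a2 x + b1 x) / 2 - (a2 x - b1 x) / 2) \<longlongrightarrow> \<zeta>) at_top"
        by (simp flip: diff_divide_distrib)
      show "(a \<sigma>0 + B \<sigma>0) / 2 + (a \<sigma>0 - B \<sigma>0) / 2 = N1 * \<sigma>0" using a(2) front0 by (simp add: field_simps)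
      show "N1 < 2 * ((a1 \<sigma>0 + b \<sigma>0) / 2)" using speed' by simp
    qed (use \<sigma>0 \<tau> in auto)
    show "chi0 s = (a s + B s) / 2 + (a s - B s) / 2" if "\<sigma>0 \<le> s" for s using a_eq[OF that] by (simp add: field_simps)
    show "trace ?R chi1 s = (a1 s + b s) / 2 - (a1 s - b s) / 2" if "\<sigma>0 \<le> s" for s using b_eq[OF that] by (simp add: field_simps)
  qed
qed

theorem theorem3p3:
  fixes N1 \<eta> \<tau> \<zeta> :: real and chi0 chi1 :: "real \<Rightarrow> real"
  assumes "N1 > 1" and "0 < \<eta>" and "\<eta> < N1" and "\<eta> < \<tau>" and "\<tau> < N1" and "\<zeta> \<ge> 0"
  shows "\<exists>T>0. \<forall>N0. shock_front_initial_data N1 \<eta> \<tau> \<zeta> chi0 chi1 N0 \<longrightarrow>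
    (\<exists>chi N \<sigma>. classical_shock_solution N1 \<eta> \<tau> \<zeta> chi0 chi1 N0 T chi N \<and>
       is_shock_front N1 \<eta> \<tau> \<zeta> chi0 chi1 N0 T chi N \<sigma> \<and>
       (\<forall>chi' N'. classical_shock_solution N1 \<eta> \<tau> \<zeta> chi0 chi1 N0 T chi' N' \<longrightarrow>
          same_shock_solution T \<sigma> chi N chi' N'))"
proof (cases "\<exists>N0. shock_front_initial_data N1 \<eta> \<tau> \<zeta> chi0 chi1 N0")
  \<comment> \<open>With no admissible \<open>N0\<close> the claim is vacuous, and any T will
    do.\<close>
  case False
  then show ?thesis by (intro exI[of _ 1]) auto
next
  case True
  then obtain M where M: "shock_front_initial_data N1 \<eta> \<tau> \<zeta> chi0 chi1 M" by blast
  then obtain \<sigma>0 where initM: "is_initial_front N1 \<eta> \<tau> \<zeta> chi0 chi1 M \<sigma>0"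
    and c: "continuous_on {0..} chi0"
    by (auto simp: shock_front_initial_data_def)
  obtain P P1 P2 Q Q1 Q2 where fp: "front_problem N1 \<eta> \<tau> \<zeta> \<sigma>0 P P1 P2 Q Q1 Q2"
    and c0: "\<And>s. \<sigma>0 \<le> s \<Longrightarrow> chi0 s = P s + Q s"
    and c1: "\<And>s. \<sigma>0 \<le> s \<Longrightarrow> trace {\<sigma>0..} chi1 s = P1 s - Q1 s"
    using data_front_problem[OF initM c assms(4,5)] by blast
  obtain T \<sigma> where sol: "front_solution N1 \<eta> \<tau> \<zeta> \<sigma>0 P P1 P2 Q Q1 Q2 T \<sigma>"
    by (rule front_problem.exists_front[OF fp])
  interpret front_solution N1 \<eta> \<tau> \<zeta> \<sigma>0 P P1 P2 Q Q1 Q2 T \<sigma> by (rule sol)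
  \<comment> \<open>Every admissible \<open>N0\<close> has the same initial front as
    \<open>M\<close>, so a single front problem, and hence a single T, serves them all.\<close>
  have init: "initial_front N1 \<eta> \<tau> \<zeta> chi0 chi1 N0 = \<sigma>0" if "shock_front_initial_data N1 \<eta> \<tau> \<zeta> chi0 chi1 N0" for N0
  proof -
    have "\<exists>!\<sigma>. is_initial_front N1 \<eta> \<tau> \<zeta> chi0 chi1 N0 \<sigma>"
      using that by (simp add: shock_front_initial_data_def)
    from theI'[OF this] have "is_initial_front N1 \<eta> \<tau> \<zeta> chi0 chi1 N0 (initial_front N1 \<eta> \<tau> \<zeta> chi0 chi1 N0)"
      by (simp only: initial_front_def)
    from initial_front_unique[OF this initM] show ?thesis .
  qed
  show ?thesis
    using T classical_solution[OF init c0 c1] by blast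
qed

end
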